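(* Let $G$ be a graph with edge ideal $I = I(G)$, and let $\nu(G)$ denote its induced matching number. Then for all integers $s \ge 1$, we have $$\operatorname{reg}(I^s) \ge 2s + \nu(G) - 1.$$
   Context: Graphs are finite and simple (no loops, no multiple edges). Let $k$ be a field and let $G=(V,E)$ be a graph with vertex set $V=\{x_1,\dots,x_n\}$, identified with the variables of the standard graded polynomial ring $R=k[x_1,\dots,x_n]$. The edge ideal of $G$ is $I(G)=(uv \mid \{u,v\}\in E)\subseteq R$. For a finitely generated graded $R$-module $T$ with graded Betti numbers $\beta_{i,j}(T)$ (the number of copies of $R(-j)$ in homological degree $i$ of the minimal graded free resolution of $T$), the (Castelnuovo-Mumford) regularity is $\operatorname{reg}(T)=\max\{j-i \mid \beta_{i,j}(T)\neq 0\}$; for an ideal $I$, $\operatorname{reg}(I)$ is the regularity of $I$ as an $R$-module. An induced matching of $G$ is a set of pairwise disjoint edges $\{e_1,\dots,e_r\}$ of $G$ that are the only edges of the induced subgraph of $G$ on the vertex set $\bigcup_{i=1}^r e_i$; the induced matching number $\nu(G)$ is the largest size of an induced matching of $G$. *)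

theory Defs
  imports
    "HOL-Library.Poly_Mapping"
    "HOL-Library.Extended_Real"
    "Jordan_Normal_Form.Matrix_Kernel"
begin

section \<open>Graphs and induced matchings\<close>

text \<open>The vertex set is the (arbitrary) finite type of the vertices; a graph is given by its edges.\<close>

definition simple_graph :: "'v::finite set set \<Rightarrow> bool" where
  "simple_graph E \<longleftrightarrow> (\<forall>e\<in>E. card e = 2)"

definition induced_matching :: "'v::finite set set \<Rightarrow> 'v set set \<Rightarrow> bool" where
  "induced_matching E M \<longleftrightarrow>
     M \<subseteq> E \<and> pairwise disjnt M \<and> {e \<in> E. e \<subseteq> \<Union>M} = M"

definition induced_matching_number :: "'v::finite set set \<Rightarrow> nat" where
  "induced_matching_number E = Max {card M | M. induced_matching E M}"


section \<open>The standard graded polynomial ring and its ideals\<close>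

text \<open>Exponent vectors are finitely supported maps to the naturals, polynomials are finitely
  supported maps from exponent vectors to coefficients; multiplication is convolution.\<close>

type_synonym ('v, 'k) mpoly = "('v \<Rightarrow>\<^sub>0 nat) \<Rightarrow>\<^sub>0 'k"

definition var :: "'v \<Rightarrow> ('v, 'k::comm_ring_1) mpoly" where
  "var x = Poly_Mapping.single (Poly_Mapping.single x 1) 1"

definition mon_degree :: "('v::finite \<Rightarrow>\<^sub>0 nat) \<Rightarrow> nat" where
  "mon_degree m = (\<Sum>x\<in>UNIV. Poly_Mapping.lookup m x)"

text \<open>The graded component of degree \<open>j\<close>; it is \<open>{0}\<close> for negative \<open>j\<close>.\<close>

definition homog :: "int \<Rightarrow> ('v::finite, 'k::comm_ring_1) mpoly set" where
  "homog j = {p. \<forall>m \<in> Poly_Mapping.keys p. int (mon_degree m) = j}"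

text \<open>A commutative ring is a module over itself and its ideals are the submodules; the locale
  name is qualified since HOL-Algebra has a locale of the same name.\<close>

definition ideal_gen :: "'a::comm_ring_1 set \<Rightarrow> 'a set" where
  "ideal_gen S = Modules.module.span (*) S"

primrec ideal_power :: "'a::comm_ring_1 set \<Rightarrow> nat \<Rightarrow> 'a set" where
  "ideal_power I 0 = UNIV"
| "ideal_power I (Suc s) = ideal_gen {a * b | a b. a \<in> I \<and> b \<in> ideal_power I s}"

definition edge_ideal :: "'v::finite set set \<Rightarrow> ('v, 'k::comm_ring_1) mpoly set" where
  "edge_ideal E = ideal_gen {var u * var v | u v. {u, v} \<in> E}"

definition irrelevant_ideal :: "('v::finite, 'k::comm_ring_1) mpoly set" where
  "irrelevant_ideal = ideal_gen (range var)"


section \<open>Minimal graded free resolutions and regularity\<close>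

text \<open>
  Data of a graded free resolution of a module: in homological degree \<open>i\<close> the free module
  \<open>F\<^sub>i = R(- shift i 0) \<oplus> \<dots> \<oplus> R(- shift i (rk i - 1))\<close>, whose \<open>b\<close>-th basis element has degree
  \<open>shift i b\<close>; the matrix \<open>bd i\<close> of the map from \<open>F\<^sub>i\<^sub>+\<^sub>1\<close> to \<open>F\<^sub>i\<close>; and the images \<open>aug b\<close> of
  the basis elements of \<open>F\<^sub>0\<close> in the module.
\<close>

record ('r, 'm) free_res =
  rk :: "nat \<Rightarrow> nat"
  shift :: "nat \<Rightarrow> nat \<Rightarrow> int"
  bd :: "nat \<Rightarrow> 'r mat"
  aug :: "nat \<Rightarrow> 'm"

definition aug_map ::
  "(('v, 'k::comm_ring_1) mpoly \<Rightarrow> 'm::ab_group_add \<Rightarrow> 'm) \<Rightarrow> (('v, 'k) mpoly, 'm) free_res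
    \<Rightarrow> ('v, 'k) mpoly vec \<Rightarrow> 'm" where
  "aug_map scl F w = (\<Sum>b<rk F 0. scl (w $ b) (aug F b))"

text \<open>
  The resolved module is a submodule \<open>T\<close> of an ambient module with scalar multiplication
  \<open>scl\<close>, and \<open>gr j\<close> is the set of homogeneous elements of degree \<open>j\<close> of the ambient module.
  The conditions on \<open>aug\<close> and \<open>bd\<close> involving \<open>shift\<close> say that all maps are homogeneous of
  degree 0. Minimality is the last condition: every differential maps \<open>F\<^sub>i\<^sub>+\<^sub>1\<close> into
  \<open>m F\<^sub>i\<close>, where \<open>m\<close> is the irrelevant ideal.
\<close>

definition minimal_graded_free_resolution ::
  "(('v::finite, 'k::comm_ring_1) mpoly \<Rightarrow> 'm::ab_group_add \<Rightarrow> 'm) \<Rightarrow> (int \<Rightarrow> 'm set) \<Rightarrow> 'm set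
    \<Rightarrow> (('v, 'k) mpoly, 'm) free_res \<Rightarrow> bool" where
  "minimal_graded_free_resolution scl gr T F \<longleftrightarrow>
     (\<forall>i. bd F i \<in> carrier_mat (rk F i) (rk F (Suc i))) \<and>
     (\<forall>b<rk F 0. aug F b \<in> gr (shift F 0 b)) \<and>
     (\<forall>i. \<forall>a<rk F i. \<forall>b<rk F (Suc i).
        bd F i $$ (a, b) \<in> homog (shift F (Suc i) b - shift F i a)) \<and>
     aug_map scl F ` carrier_vec (rk F 0) = T \<and>
     {w \<in> carrier_vec (rk F 0). aug_map scl F w = 0}
       = (*\<^sub>v) (bd F 0) ` carrier_vec (rk F 1) \<and>
     (\<forall>i. mat_kernel (bd F i)
       = (*\<^sub>v) (bd F (Suc i)) ` carrier_vec (rk F (Suc (Suc i)))) \<and>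
     (\<forall>i. \<forall>a<rk F i. \<forall>b<rk F (Suc i). bd F i $$ (a, b) \<in> irrelevant_ideal)"

text \<open>
  The number of copies of \<open>R(-j)\<close> in homological degree \<open>i\<close>. The choice is immaterial for a
  finitely generated graded module over a field: a minimal graded free resolution exists and is
  unique up to isomorphism.
\<close>

definition graded_betti ::
  "(('v::finite, 'k::comm_ring_1) mpoly \<Rightarrow> 'm::ab_group_add \<Rightarrow> 'm) \<Rightarrow> (int \<Rightarrow> 'm set) \<Rightarrow> 'm set
    \<Rightarrow> nat \<Rightarrow> int \<Rightarrow> nat" where
  "graded_betti scl gr T i j =
     (let F = (SOME F. minimal_graded_free_resolution scl gr T F)
      in card {b. b < rk F i \<and> shift F i b = j})"

text \<open>
  The regularity is the largest \<open>j - i\<close> with non-zero graded Betti number. It is taken as a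
  supremum in the extended reals: for a non-zero finitely generated module the set is finite and
  non-empty (by the syzygy theorem), so this is its maximum, and the zero module has
  regularity \<open>- \<infinity>\<close>.
\<close>

definition regularity ::
  "(('v::finite, 'k::comm_ring_1) mpoly \<Rightarrow> 'm::ab_group_add \<Rightarrow> 'm) \<Rightarrow> (int \<Rightarrow> 'm set) \<Rightarrow> 'm set
    \<Rightarrow> ereal" where
  "regularity scl gr T =
     Sup {ereal (real_of_int (j - int i)) | i j. graded_betti scl gr T i j \<noteq> 0}"

definition ideal_regularity :: "('v::finite, 'k::comm_ring_1) mpoly set \<Rightarrow> ereal" where
  "ideal_regularity I = regularity (*) homog I"

end

theory Submission
  imports Defs "HOL-Library.Function_Algebras"
begin

text \<open>
  Let \<open>J = I\<^sup>s\<close> and let \<open>{a\<^sub>l, b\<^sub>l}\<close> be an induced matching with \<open>\<nu>\<close> edges. With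
  \<open>W = (a\<^sub>1 b\<^sub>1)\<^sup>s\<^sup>-\<^sup>1 a\<^sub>1 \<cdots> a\<^sub>\<nu>\<close>, the Koszul boundary of \<open>W e\<^sub>b\<close>, where \<open>e\<^sub>b\<close> is the wedge of the
  basis elements of all \<open>b\<^sub>l\<close>, has coefficients in \<open>J\<close>, so it is a Koszul cycle over \<open>J\<close> in homological
  degree \<open>\<nu> - 1\<close> and internal degree \<open>2 s + 2 \<nu> - 2\<close>. It does not bound over \<open>J\<close>: the sum of
  suitable coefficients over all transversals of the matching vanishes on boundaries of the Koszul
  complex of \<open>R\<close> and on chains over \<open>J\<close>, but not on \<open>W e\<^sub>b\<close>. It vanishes on chains over \<open>J\<close> because a transversal together
  with the vertices outside of the matching is a vertex cover, so that every monomial of \<open>J\<close> has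
  degree at least \<open>s\<close> in it. Dimension shifting along any graded free resolution of \<open>J\<close> turns
  the class into a generator of degree \<open>2 s + 2 \<nu> - 2\<close> in homological degree \<open>\<nu> - 1\<close>.

  As Betti numbers are defined through a choice, a minimal graded free resolution has to be shown to
  exist; this is done with multigraded modules, which is enough for monomial ideals.
\<close>

section \<open>Polynomials as finitely supported maps\<close>

abbreviation lookup :: "('a \<Rightarrow>\<^sub>0 'b::zero) \<Rightarrow> 'a \<Rightarrow> 'b" where
  "lookup \<equiv> Poly_Mapping.lookup"
abbreviation keys :: "('a \<Rightarrow>\<^sub>0 'b::zero) \<Rightarrow> 'a set" where
  "keys \<equiv> Poly_Mapping.keys"
abbreviation single :: "'a \<Rightarrow> 'b::zero \<Rightarrow> ('a \<Rightarrow>\<^sub>0 'b)" where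
  "single \<equiv> Poly_Mapping.single"

interpretation idl: Modules.module "(*) :: 'a::comm_ring_1 \<Rightarrow> 'a \<Rightarrow> 'a"
  by unfold_locales (simp_all add: algebra_simps)

(* As a simp rule this loops together with mult.assoc. *)
declare idl.scale_scale [simp del]

text \<open>Free modules of every finite rank sit inside one module of functions on
  \<open>nat\<close>, so the rank can vary with the homological degree without a change of
  type.\<close>

definition fscale :: "'a::comm_ring_1 \<Rightarrow> (nat \<Rightarrow> 'a) \<Rightarrow> nat \<Rightarrow> 'a" where
  "fscale c f = (\<lambda>b. c * f b)"

lemma fscale_apply [simp]: "fscale c f b = c * f b"
  by (simp add: fscale_def)

interpretation fm: Modules.module "fscale :: 'a::comm_ring_1 \<Rightarrow> (nat \<Rightarrow> 'a) \<Rightarrow> nat \<Rightarrow> 'a"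
  by unfold_locales (simp_all add: fun_eq_iff algebra_simps)

lemma lookup_single_mult_add:
  fixes p :: "('a::cancel_comm_monoid_add \<Rightarrow>\<^sub>0 'k::comm_ring_1)"
  shows "lookup (single k c * p) (k + m) = c * lookup p m"
proof -
  have "lookup (single k c * p) (k + m) = (\<Sum>l. (c when k = l) * (\<Sum>q. lookup p q when k + m = l + q))"
    by (simp add: lookup_mult lookup_single)
  also have "\<dots> = c * (\<Sum>q. lookup p q when k + m = k + q)"
    by (simp add: when_mult)
  also have "\<dots> = c * lookup p m"
    by simp
  finally show ?thesis .
qed

lemma lookup_single_mult_eq_0:
  fixes p :: "('a::cancel_comm_monoid_add \<Rightarrow>\<^sub>0 'k::comm_ring_1)"
  assumes "\<And>n. m \<noteq> k + n"
  shows "lookup (single k c * p) m = 0"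
proof (rule ccontr)
  assume "lookup (single k c * p) m \<noteq> 0"
  then have "m \<in> keys (single k c * p)" by (simp add: in_keys_iff)
  then obtain a b where "m = a + b" "a \<in> keys (single k c)" using keys_mult by blast
  with assms show False by (cases "c = 0") auto
qed

lemma poly_eq_sum_single: "p = (\<Sum>m\<in>keys p. single m (lookup p m))"
proof (rule poly_mapping_eqI)
  fix k
  have "lookup (\<Sum>m\<in>keys p. single m (lookup p m)) k = (\<Sum>m\<in>keys p. if m = k then lookup p m else 0)"
    by (simp add: lookup_sum lookup_single when_def)
  also have "\<dots> = lookup p k" by (simp add: in_keys_iff)
  finally show "lookup p k = lookup (\<Sum>m\<in>keys p. single m (lookup p m)) k" by simp
qed

section \<open>Components of a polynomial with respect to a grading\<close>

definition pfilter :: "('a \<Rightarrow> bool) \<Rightarrow> ('a \<Rightarrow>\<^sub>0 'k::comm_monoid_add) \<Rightarrow> ('a \<Rightarrow>\<^sub>0 'k)" where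
  "pfilter P p = (\<Sum>m | m \<in> keys p \<and> P m. single m (lookup p m))"

lemma lookup_pfilter: "lookup (pfilter P p) k = (if P k then lookup p k else 0)"
proof -
  have "lookup (pfilter P p) k = (\<Sum>m | m \<in> keys p \<and> P m. if m = k then lookup p m else 0)"
    by (simp add: pfilter_def lookup_sum lookup_single when_def)
  also have "\<dots> = (if P k then lookup p k else 0)" by (simp add: in_keys_iff)
  finally show ?thesis .
qed

lemma keys_pfilter: "keys (pfilter P p) = {m \<in> keys p. P m}"
  by (auto simp: in_keys_iff lookup_pfilter split: if_splits)

lemma pfilter_add: "pfilter P (p + q) = pfilter P p + pfilter P q"
  by (rule poly_mapping_eqI) (simp add: lookup_pfilter lookup_add)

lemma pfilter_zero [simp]: "pfilter P 0 = 0"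
  by (rule poly_mapping_eqI) (simp add: lookup_pfilter)

lemma pfilter_sum: "pfilter P (\<Sum>i\<in>A. f i) = (\<Sum>i\<in>A. pfilter P (f i))"
  by (induction A rule: infinite_finite_induct) (simp_all add: pfilter_add)

lemma pfilter_id: "(\<And>m. m \<in> keys p \<Longrightarrow> P m) \<Longrightarrow> pfilter P p = p"
  by (rule poly_mapping_eqI) (auto simp: lookup_pfilter in_keys_iff)

lemma pfilter_eq_0: "(\<And>m. m \<in> keys p \<Longrightarrow> \<not> P m) \<Longrightarrow> pfilter P p = 0"
  by (rule poly_mapping_eqI) (auto simp: lookup_pfilter in_keys_iff)

text \<open>Multiplication by \<open>a\<close> carries the part of \<open>p\<close> inside
  \<open>P\<close> into \<open>Q\<close> and the rest out of \<open>Q\<close>. With \<open>P\<close>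
  and \<open>Q\<close> fixing degrees, this says that a homogeneous factor commutes with taking
  components.\<close>

lemma pfilter_mult:
  fixes a p :: "('a::comm_monoid_add \<Rightarrow>\<^sub>0 'k::comm_ring_1)"
  assumes "\<And>k m. k \<in> keys a \<Longrightarrow> Q (k + m) \<longleftrightarrow> P m"
  shows "pfilter Q (a * p) = a * pfilter P p"
proof -
  have "p = pfilter P p + pfilter (\<lambda>m. \<not> P m) p"
    by (rule poly_mapping_eqI) (simp add: lookup_pfilter lookup_add)
  then have "a * p = a * pfilter P p + a * pfilter (\<lambda>m. \<not> P m) p"
    by (metis distrib_left)
  moreover have "pfilter Q (a * pfilter P p) = a * pfilter P p"
    using keys_mult[of a "pfilter P p"] assms by (intro pfilter_id) (fastforce simp: keys_pfilter)
  moreover have "pfilter Q (a * pfilter (\<lambda>m. \<not> P m) p) = 0"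
    using keys_mult[of a "pfilter (\<lambda>m. \<not> P m) p"] assms by (intro pfilter_eq_0) (fastforce simp: keys_pfilter)
  ultimately show ?thesis by (simp add: pfilter_add)
qed

lemma sum_pfilter:
  assumes "finite D" "\<And>m. m \<in> keys p \<Longrightarrow> f m \<in> D"
  shows "(\<Sum>\<delta>\<in>D. pfilter (\<lambda>m. f m = \<delta>) p) = p"
proof (rule poly_mapping_eqI)
  fix k
  have "lookup (\<Sum>\<delta>\<in>D. pfilter (\<lambda>m. f m = \<delta>) p) k = (\<Sum>\<delta>\<in>D. if f k = \<delta> then lookup p k else 0)"
    by (simp add: lookup_sum lookup_pfilter)
  also have "\<dots> = lookup p k" using assms by (auto simp: in_keys_iff)
  finally show "lookup (\<Sum>\<delta>\<in>D. pfilter (\<lambda>m. f m = \<delta>) p) k = lookup p k" .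
qed

section \<open>Total degree\<close>

lemma mon_degree_add: "mon_degree (m + n) = mon_degree m + mon_degree n"
  by (simp add: mon_degree_def lookup_add sum.distrib)

lemma mon_degree_single: "mon_degree (single v k) = k"
  by (simp add: mon_degree_def lookup_single when_def)

lemma mon_degree_eq_0_iff: "mon_degree m = 0 \<longleftrightarrow> m = 0"
  by (auto simp: mon_degree_def intro: poly_mapping_eqI)

lemma mon_degree_zero [simp]: "mon_degree 0 = 0"
  by (simp add: mon_degree_eq_0_iff)

lemma homogD: "p \<in> homog j \<Longrightarrow> m \<in> keys p \<Longrightarrow> int (mon_degree m) = j"
  by (simp add: homog_def)

lemma homog_zero [simp]: "0 \<in> homog j"
  by (simp add: homog_def)

lemma homog_add: "p \<in> homog j \<Longrightarrow> q \<in> homog j \<Longrightarrow> p + q \<in> homog j"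
  using keys_add[of p q] by (auto simp: homog_def)

lemma homog_sum: "(\<And>i. i \<in> A \<Longrightarrow> f i \<in> homog j) \<Longrightarrow> sum f A \<in> homog j"
  by (induction A rule: infinite_finite_induct) (simp_all add: homog_add)

lemma homog_mult: "p \<in> homog i \<Longrightarrow> q \<in> homog j \<Longrightarrow> p * q \<in> homog (i + j)"
  using keys_mult[of p q] by (fastforce simp: homog_def mon_degree_add)

lemma homog_var: "var v \<in> homog 1"
  by (simp add: homog_def var_def mon_degree_single)

lemma pfilter_homog: "pfilter (\<lambda>m. c + int (mon_degree m) = d) p \<in> homog (d - c)"
  by (auto simp: homog_def keys_pfilter)

section \<open>Splitting off and dividing by variables\<close>

lemma decompose_mon: "v \<in> keys m \<Longrightarrow> m = single v 1 + (m - single v 1)" for m :: "'v \<Rightarrow>\<^sub>0 nat"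
  by (rule poly_mapping_eqI) (auto simp: lookup_add lookup_minus lookup_single when_def in_keys_iff)

lemma sum_var_mult:
  fixes p :: "('v::finite, 'k::comm_ring_1) mpoly"
  assumes "lookup p 0 = 0"
  shows "\<exists>w. p = (\<Sum>v\<in>UNIV. var v * w v)"
proof -
  let ?L = "\<lambda>p::('v, 'k) mpoly. \<exists>w. p = (\<Sum>v\<in>UNIV. var v * w v)"
  have sg: "?L (single m (lookup p m))" if "m \<in> keys p" for m
  proof -
    have "m \<noteq> 0" using that assms by (auto simp: in_keys_iff)
    then obtain u where u: "u \<in> keys m" by (meson equals0I keys_eq_empty)
    let ?w = "\<lambda>v. if v = u then single (m - single u 1) (lookup p m) else 0"
    have "(\<Sum>v\<in>UNIV. var v * ?w v) = var u * single (m - single u 1) (lookup p m)"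
      by (subst sum.mono_neutral_right[of _ "{u}"]) auto
    also have "\<dots> = single m (lookup p m)"
      by (simp only: var_def mult_single decompose_mon[OF u, symmetric] mult_1_left)
    finally show ?thesis by (intro exI[of _ ?w]) (rule sym)
  qed
  have "finite A \<Longrightarrow> (\<And>i. i \<in> A \<Longrightarrow> ?L (f i)) \<Longrightarrow> ?L (sum f A)"
    for A and f :: "_ \<Rightarrow> ('v, 'k) mpoly"
  proof (induction A rule: finite_induct)
    case empty
    show ?case by (intro exI[of _ "\<lambda>_. 0"]) simp
  next
    case (insert i A)
    then obtain w w' where "f i = (\<Sum>v\<in>UNIV. var v * w v)" "sum f A = (\<Sum>v\<in>UNIV. var v * w' v)"
      by blast
    then show ?case using insert
      by (intro exI[of _ "\<lambda>v. w v + w' v"]) (simp add: distrib_left sum.distrib)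
  qed
  from this[of "keys p" "\<lambda>m. single m (lookup p m)"] sg show ?thesis
    using poly_eq_sum_single[of p] by auto
qed

lemma irrelevant_idealI: "lookup p 0 = 0 \<Longrightarrow> p \<in> irrelevant_ideal"
proof -
  assume "lookup p 0 = 0"
  then obtain w where "p = (\<Sum>v\<in>UNIV. var v * w v)" using sum_var_mult by blast
  then have "p = (\<Sum>v\<in>UNIV. w v * var v)" by (simp add: mult.commute)
  then show ?thesis unfolding irrelevant_ideal_def ideal_gen_def
    by (simp add: idl.span_sum idl.span_scale idl.span_base)
qed

text \<open>A left inverse of multiplication by \<open>var v\<close> that discards the monomials not
  divisible by \<open>v\<close>. It commutes with the other variables, which makes it fit for a
  contracting homotopy.\<close>

definition var_quot :: "'v \<Rightarrow> ('v::finite, 'k::comm_ring_1) mpoly \<Rightarrow> ('v, 'k) mpoly" where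
  "var_quot v = Poly_Mapping.map_key ((+) (single v 1))"

lemma lookup_var_quot: "lookup (var_quot v p) m = lookup p (single v 1 + m)"
  by (simp add: var_quot_def map_key.rep_eq)

lemma var_quot_add: "var_quot v (p + q) = var_quot v p + var_quot v q"
  by (rule poly_mapping_eqI) (simp add: lookup_var_quot lookup_add)

lemma var_quot_zero [simp]: "var_quot v 0 = 0"
  by (rule poly_mapping_eqI) (simp add: lookup_var_quot)

lemma var_quot_uminus: "var_quot v (- p) = - var_quot v p"
  by (rule poly_mapping_eqI) (simp add: lookup_var_quot)

lemma var_quot_sum: "var_quot v (sum f A) = (\<Sum>i\<in>A. var_quot v (f i))"
  by (induction A rule: infinite_finite_induct) (simp_all add: var_quot_add)

lemma var_quot_same [simp]: "var_quot v (var v * p) = p"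
  by (rule poly_mapping_eqI) (simp add: lookup_var_quot var_def lookup_single_mult_add)

lemma lookup_var_mult:
  fixes p :: "('v::finite, 'k::comm_ring_1) mpoly"
  shows "lookup (var v * p) m = (if lookup m v = 0 then 0 else lookup p (m - single v 1))"
proof (cases "lookup m v = 0")
  case True
  have "m \<noteq> single v 1 + n" for n
  proof
    assume "m = single v 1 + n"
    then have "lookup m v = 1 + lookup n v" by (simp add: lookup_add)
    with True show False by simp
  qed
  with True show ?thesis by (simp add: var_def lookup_single_mult_eq_0)
next
  case False
  then have "m = single v 1 + (m - single v 1)" by (intro decompose_mon) (simp add: in_keys_iff)
  with False show ?thesis
    using lookup_single_mult_add[of "single v 1" 1 p "m - single v 1"] by (simp add: var_def)
qed

lemma var_quot_other:
  fixes p :: "('v::finite, 'k::comm_ring_1) mpoly"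
  assumes "u \<noteq> v"
  shows "var_quot v (var u * p) = var u * var_quot v p"
proof (rule poly_mapping_eqI)
  fix m :: "'v \<Rightarrow>\<^sub>0 nat"
  have "lookup m u \<noteq> 0 \<Longrightarrow> single v 1 + m - single u 1 = single v 1 + (m - single u 1)"
    using assms by (intro poly_mapping_eqI) (auto simp: lookup_add lookup_minus lookup_single when_def)
  then show "lookup (var_quot v (var u * p)) m = lookup (var u * var_quot v p) m"
    using assms by (auto simp: lookup_var_quot lookup_var_mult lookup_add lookup_single)
qed

section \<open>The Koszul complex\<close>

text \<open>The sign of moving \<open>v\<close> to its place in the wedge product over
  \<open>S\<close>, with places ordered by \<rho>. Keeping \<rho> as a parameter allows an order
  adapted to the matching.\<close>

definition ksign :: "('v \<Rightarrow> nat) \<Rightarrow> 'v \<Rightarrow> 'v set \<Rightarrow> 'r::comm_ring_1" where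
  "ksign \<rho> v S = (- 1) ^ card {u \<in> S. \<rho> u < \<rho> v}"

text \<open>A chain is the family of its coefficients at the wedge products over all
  \<open>S\<close>; the homological degree is \<open>card S\<close>. The formula reads off the
  coefficient of the boundary at \<open>S\<close>.\<close>

definition koszul ::
  "('v::finite \<Rightarrow> nat) \<Rightarrow> ('v set \<Rightarrow> ('v, 'k::comm_ring_1) mpoly) \<Rightarrow> 'v set \<Rightarrow> ('v, 'k) mpoly" where
  "koszul \<rho> c S = (\<Sum>v\<in>-S. ksign \<rho> v S * (var v * c (insert v S)))"

lemma ksign_square [simp]: "ksign \<rho> v S * ksign \<rho> v S = 1"
  by (simp add: ksign_def flip: power_add mult_2)

lemma ksign_cases: "ksign \<rho> v S = 1 \<or> ksign \<rho> v S = - 1"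
  unfolding ksign_def by (cases "even (card {u \<in> S. \<rho> u < \<rho> v})") auto

lemma ksign_mult_cases: "ksign \<rho> v S * p = p \<or> ksign \<rho> v S * p = - p"
  using ksign_cases by (metis mult_1 mult_minus1)

lemma ksign_insert:
  fixes S :: "'v::finite set"
  assumes "u \<notin> S"
  shows "ksign \<rho> v (insert u S) = (if \<rho> u < \<rho> v then - ksign \<rho> v S else ksign \<rho> v S)"
proof -
  have "{x \<in> insert u S. \<rho> x < \<rho> v} =
      (if \<rho> u < \<rho> v then insert u {x \<in> S. \<rho> x < \<rho> v} else {x \<in> S. \<rho> x < \<rho> v})"
    by auto
  then show ?thesis using assms by (simp add: ksign_def)
qed

lemma ksign_swap:
  fixes S :: "'v::finite set"
  assumes "inj \<rho>" "u \<noteq> v" "u \<notin> S" "v \<notin> S"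
  shows "ksign \<rho> u S * ksign \<rho> v (insert u S) = - (ksign \<rho> v S * ksign \<rho> u (insert v S))"
proof -
  have "\<rho> u \<noteq> \<rho> v" using assms by (simp add: inj_eq)
  then show ?thesis using assms by (auto simp: ksign_insert mult.commute)
qed

text \<open>Exchanging the entries of the pairs only shows that the sum is its own negative, which
  is not enough in characteristic 2. Hence the pairs are split by the order \<rho> into two halves
  that cancel.\<close>

lemma sum_antisym_eq_0:
  fixes f :: "'a \<Rightarrow> 'a \<Rightarrow> 'b::ab_group_add" and \<rho> :: "'a \<Rightarrow> nat"
  assumes "finite P" "\<And>u v. (u, v) \<in> P \<Longrightarrow> (v, u) \<in> P"
    and "\<And>u v. (u, v) \<in> P \<Longrightarrow> \<rho> u \<noteq> \<rho> v"
    and "\<And>u v. (u, v) \<in> P \<Longrightarrow> f v u = - f u v"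
  shows "(\<Sum>(u, v)\<in>P. f u v) = 0"
proof -
  let ?L = "{(u, v) \<in> P. \<rho> u < \<rho> v}" and ?G = "{(u, v) \<in> P. \<rho> v < \<rho> u}"
  have fin: "finite ?L" "finite ?G" using assms(1) by (auto intro: finite_subset[OF _ assms(1)])
  have "P = ?L \<union> ?G" using assms(3) by (auto, meson nat_neq_iff)
  then have "(\<Sum>(u, v)\<in>P. f u v) = (\<Sum>(u, v)\<in>?L \<union> ?G. f u v)" by (rule arg_cong)
  also have "\<dots> = (\<Sum>(u, v)\<in>?L. f u v) + (\<Sum>(u, v)\<in>?G. f u v)"
    by (rule sum.union_disjoint[OF fin]) auto
  also have "(\<Sum>(u, v)\<in>?G. f u v) = (\<Sum>(u, v)\<in>?L. - f u v)"
  proof (rule sum.reindex_bij_witness[of _ prod.swap prod.swap])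
    fix a assume "a \<in> ?G"
    then obtain u v where a: "a = (u, v)" "(u, v) \<in> P" "\<rho> v < \<rho> u" by blast
    show "prod.swap a \<in> ?L" using a(3) assms(2)[OF a(2)] by (simp add: a(1))
    show "(case prod.swap a of (u, v) \<Rightarrow> - f u v) = (case a of (u, v) \<Rightarrow> f u v)"
      using assms(4)[OF a(2)] by (simp add: a(1))
  next
    fix a assume "a \<in> ?L"
    then obtain u v where a: "a = (u, v)" "(u, v) \<in> P" "\<rho> u < \<rho> v" by blast
    show "prod.swap a \<in> ?G" using a(3) assms(2)[OF a(2)] by (simp add: a(1))
  qed simp_all
  also have "(\<Sum>(u, v)\<in>?L. - f u v) = - (\<Sum>(u, v)\<in>?L. f u v)"
    by (simp add: sum_negf case_prod_beta)
  finally show ?thesis by simp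
qed

text \<open>Two elements can be removed from a set in either order, and \<open>ksign_swap\<close>
  gives the two orders opposite signs.\<close>

lemma koszul_koszul:
  assumes "inj \<rho>"
  shows "koszul \<rho> (koszul \<rho> c) S = 0"
proof -
  let ?P = "SIGMA u:-S. - insert u S"
  let ?f = "\<lambda>u v. (ksign \<rho> u S * ksign \<rho> v (insert u S)) * (var u * var v * c (insert v (insert u S)))"
  have "koszul \<rho> (koszul \<rho> c) S = (\<Sum>u\<in>-S. \<Sum>v\<in>- insert u S. ?f u v)"
    unfolding koszul_def sum_distrib_left by (intro sum.cong) (auto simp: algebra_simps)
  also have "\<dots> = (\<Sum>(u, v)\<in>?P. ?f u v)" by (simp add: sum.Sigma)
  also have "\<dots> = 0"
  proof (rule sum_antisym_eq_0)
    show "\<And>u v. (u, v) \<in> ?P \<Longrightarrow> \<rho> u \<noteq> \<rho> v" using assms by (auto simp: inj_eq)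
    fix u v assume "(u, v) \<in> ?P"
    then have "ksign \<rho> v S * ksign \<rho> u (insert v S) = - (ksign \<rho> u S * ksign \<rho> v (insert u S) :: ('a, 'b) mpoly)"
      using assms by (intro ksign_swap) auto
    then show "?f v u = - ?f u v" by (simp add: insert_commute mult.commute[of "var u" "var v"])
  qed auto
  finally show ?thesis .
qed

lemma koszul_diff: "koszul \<rho> (\<lambda>S. c S - c' S) S = koszul \<rho> c S - koszul \<rho> c' S"
  by (simp add: koszul_def right_diff_distrib sum_subtractf)

lemma koszul_add: "koszul \<rho> (\<lambda>S. c S + c' S) S = koszul \<rho> c S + koszul \<rho> c' S"
  by (simp add: koszul_def distrib_left sum.distrib)

lemma koszul_linear:
  "koszul \<rho> (\<lambda>S. \<Sum>j\<in>J. a j * c j S) S = (\<Sum>j\<in>J. a j * koszul \<rho> (c j) S)"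
  unfolding koszul_def sum_distrib_left by (subst sum.swap) (simp add: algebra_simps)

lemma koszul_support:
  assumes "\<And>S. card S \<noteq> Suc p \<Longrightarrow> c S = 0" "card S \<noteq> p"
  shows "koszul \<rho> c S = 0"
  unfolding koszul_def using assms by (intro sum.neutral) simp

lemma koszul_homog:
  assumes "\<And>S. c S \<in> homog j"
  shows "koszul \<rho> c S \<in> homog (j + 1)"
  unfolding koszul_def
proof (rule homog_sum)
  fix v
  have "var v * c (insert v S) \<in> homog (1 + j)" by (intro homog_mult homog_var assms)
  then show "ksign \<rho> v S * (var v * c (insert v S)) \<in> homog (j + 1)"
    using ksign_mult_cases[of \<rho> v S "var v * c (insert v S)"]
    by (auto simp: add.commute homog_def)
qed

text \<open>Contracting homotopy along a single variable: divide by \<open>v\<close> and wedge with \<open>v\<close>.\<close>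

lemma koszul_homotopy:
  fixes c :: "'v::finite set \<Rightarrow> ('v, 'k::comm_ring_1) mpoly" and v :: 'v
  assumes "inj \<rho>" and cyc: "\<And>S. koszul \<rho> c S = 0"
  defines "h \<equiv> \<lambda>S. if v \<in> S then ksign \<rho> v (S - {v}) * var_quot v (c (S - {v})) else 0"
  assumes "v \<in> S"
  shows "koszul \<rho> h S = c S"
proof -
  define S' where "S' = S - {v}"
  have S: "S = insert v S'" "v \<notin> S'" using assms by (auto simp: S'_def)
  have q: "var_quot v (ksign \<rho> u T * p) = ksign \<rho> u T * var_quot v p" for u T and p :: "('v, 'k) mpoly"
    using ksign_cases[of \<rho> u T] by (metis mult_1 mult_minus1 var_quot_uminus)
  \<comment> \<open>With this sign, the boundary of \<open>h\<close> at \<open>S\<close> reproduces,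
    up to the factor \<open>- ksign \<rho> v S'\<close>, the terms of the cycle condition at
    \<open>S'\<close> other than the one for \<open>v\<close>.\<close>
  have sgn: "ksign \<rho> u S * ksign \<rho> v (insert u S') = - (ksign \<rho> v S' * ksign \<rho> u S' :: ('v, 'k) mpoly)"
    if "u \<in> - S" for u
  proof -
    have "ksign \<rho> v S' * ksign \<rho> u (insert v S') = - (ksign \<rho> u S' * ksign \<rho> v (insert u S') :: ('v, 'k) mpoly)"
      using that S assms by (intro ksign_swap) auto
    moreover have "ksign \<rho> u S = (ksign \<rho> v S' * ksign \<rho> v S') * (ksign \<rho> u (insert v S') :: ('v, 'k) mpoly)"
      using S by simp
    then have "ksign \<rho> u S = ksign \<rho> v S' * (ksign \<rho> v S' * ksign \<rho> u (insert v S') :: ('v, 'k) mpoly)"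
      by (simp only: mult.assoc)
    ultimately have "ksign \<rho> u S = - (ksign \<rho> v S' * ksign \<rho> u S' * ksign \<rho> v (insert u S') :: ('v, 'k) mpoly)"
      by (simp only: mult.assoc mult_minus_right)
    then have "ksign \<rho> u S * ksign \<rho> v (insert u S') =
        - (ksign \<rho> v S' * ksign \<rho> u S' * (ksign \<rho> v (insert u S') * ksign \<rho> v (insert u S')) :: ('v, 'k) mpoly)"
      by (simp only: mult_minus_left mult.assoc)
    then show ?thesis by simp
  qed
  have "- S' = insert v (- S)" using S by auto
  \<comment> \<open>Dividing the cycle condition at \<open>S'\<close> by \<open>v\<close> isolates
    \<open>c S\<close>: it is the only coefficient there that is multiplied by
    \<open>var v\<close>.\<close>
  then have "0 = var_quot v (ksign \<rho> v S' * (var v * c S) + (\<Sum>u\<in>-S. ksign \<rho> u S' * (var u * c (insert u S'))))"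
    using cyc[of S'] S by (simp add: koszul_def)
  also have "\<dots> = ksign \<rho> v S' * c S + (\<Sum>u\<in>-S. ksign \<rho> u S' * var_quot v (var u * c (insert u S')))"
    by (simp add: var_quot_add var_quot_sum q)
  also have "(\<Sum>u\<in>-S. ksign \<rho> u S' * var_quot v (var u * c (insert u S'))) =
      (\<Sum>u\<in>-S. ksign \<rho> u S' * (var u * var_quot v (c (insert u S'))))"
    using assms(4) by (intro sum.cong refl arg_cong2[where f = "(*)"] var_quot_other) auto
  finally have *: "(\<Sum>u\<in>-S. ksign \<rho> u S' * (var u * var_quot v (c (insert u S')))) = - (ksign \<rho> v S' * c S)"
    by (simp add: eq_neg_iff_add_eq_0 add.commute)
  have "koszul \<rho> h S = (\<Sum>u\<in>-S. ksign \<rho> u S * (var u * (ksign \<rho> v (insert u S') * var_quot v (c (insert u S')))))"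
    unfolding koszul_def
  proof (intro sum.cong refl)
    fix u assume "u \<in> - S"
    then have "insert u S - {v} = insert u S'" using S by auto
    then show "ksign \<rho> u S * (var u * h (insert u S)) =
        ksign \<rho> u S * (var u * (ksign \<rho> v (insert u S') * var_quot v (c (insert u S'))))"
      using S by (simp add: h_def)
  qed
  also have "\<dots> = (\<Sum>u\<in>-S. (ksign \<rho> u S * ksign \<rho> v (insert u S')) * (var u * var_quot v (c (insert u S'))))"
    by (intro sum.cong) (simp_all add: algebra_simps)
  also have "\<dots> = (\<Sum>u\<in>-S. - ksign \<rho> v S' * (ksign \<rho> u S' * (var u * var_quot v (c (insert u S')))))"
    by (intro sum.cong refl) (simp add: sgn mult.assoc)
  also have "\<dots> = - ksign \<rho> v S' * - (ksign \<rho> v S' * c S)"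
    by (simp only: * sum_distrib_left[symmetric])
  also have "\<dots> = (ksign \<rho> v S' * ksign \<rho> v S') * c S"
    by (simp only: minus_mult_minus mult.assoc)
  finally show ?thesis by simp
qed

text \<open>Exactness in positive homological degree. The variables are treated one at a time: after
  those in \<open>A\<close>, the corrected cycle vanishes at every set that meets \<open>A\<close>,
  and the homotopy along a new \<open>v\<close> clears the sets containing \<open>v\<close>.\<close>

lemma koszul_exact:
  fixes c :: "'v::finite set \<Rightarrow> ('v, 'k::comm_ring_1) mpoly"
  assumes "inj \<rho>" and cyc: "\<And>S. koszul \<rho> c S = 0" and supp: "\<And>S. card S \<noteq> Suc p \<Longrightarrow> c S = 0"
  shows "\<exists>t. (\<forall>S. card S \<noteq> Suc (Suc p) \<longrightarrow> t S = 0) \<and> (\<forall>S. c S = koszul \<rho> t S)"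
proof -
  have "finite A \<Longrightarrow> \<exists>t. (\<forall>S. card S \<noteq> Suc (Suc p) \<longrightarrow> t S = 0) \<and>
      (\<forall>S. S \<inter> A \<noteq> {} \<longrightarrow> c S - koszul \<rho> t S = 0)" for A :: "'v set"
  proof (induction A rule: finite_induct)
    case empty
    show ?case by (intro exI[of _ "\<lambda>_. 0"]) simp
  next
    case (insert v A)
    then obtain t where t: "\<And>S. card S \<noteq> Suc (Suc p) \<Longrightarrow> t S = 0"
      "\<And>S. S \<inter> A \<noteq> {} \<Longrightarrow> c S - koszul \<rho> t S = 0" by blast
    define c' where "c' = (\<lambda>S. c S - koszul \<rho> t S)"
    define h where "h = (\<lambda>S. if v \<in> S then ksign \<rho> v (S - {v}) * var_quot v (c' (S - {v})) else 0)"
    have "koszul \<rho> c' S = 0" for S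
      using cyc koszul_koszul[OF assms(1)] by (simp add: c'_def koszul_diff)
    then have hv: "koszul \<rho> h S = c' S" if "v \<in> S" for S
      unfolding h_def using koszul_homotopy[OF assms(1) _ that] by blast
    \<comment> \<open>As \<open>v\<close> is not in \<open>A\<close>, removing it from a set does
      not affect whether the set meets \<open>A\<close>, so the new correction leaves the earlier
      progress intact.\<close>
    have hA: "koszul \<rho> h S = 0" if "S \<inter> A \<noteq> {}" for S
      unfolding koszul_def
    proof (intro sum.neutral ballI)
      fix u
      have "(insert u S - {v}) \<inter> A \<noteq> {}" using that insert by auto
      then have "c' (insert u S - {v}) = 0" using t(2) by (simp add: c'_def)
      then show "ksign \<rho> u S * (var u * h (insert u S)) = 0" by (simp add: h_def)
    qed
    have c'supp: "c' S = 0" if "card S \<noteq> Suc p" for S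
      using supp[OF that] koszul_support[of "Suc p" t S \<rho>] t(1) that by (simp add: c'_def)
    have hsupp: "h S = 0" if "card S \<noteq> Suc (Suc p)" for S
    proof (cases "v \<in> S")
      case True
      then have "card (S - {v}) \<noteq> Suc p" using that
        by (metis Suc_inject card_Suc_Diff1 finite)
      then have "c' (S - {v}) = 0" by (rule c'supp)
      then show ?thesis by (simp add: h_def)
    qed (simp add: h_def)
    have "c S - koszul \<rho> (\<lambda>S. t S + h S) S = 0" if "S \<inter> insert v A \<noteq> {}" for S
    proof (cases "S \<inter> A = {}")
      case False
      then show ?thesis using hA[OF False] t(2)[OF False] by (simp add: koszul_add)
    next
      case True
      then have "v \<in> S" using that by auto
      from hv[OF this] show ?thesis by (simp add: koszul_add c'_def)
    qed
    then show ?case using t(1) hsupp by (intro exI[of _ "\<lambda>S. t S + h S"]) simp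
  qed
  from this[of UNIV] obtain t where t: "\<And>S. card S \<noteq> Suc (Suc p) \<Longrightarrow> t S = 0"
      "\<And>S. S \<noteq> {} \<Longrightarrow> c S - koszul \<rho> t S = 0" by auto
  \<comment> \<open>Only the empty set meets no variable; there both sides vanish because their
    homological degree is \<open>Suc p\<close>.\<close>
  have "c S = koszul \<rho> t S" for S
  proof (cases "S = {}")
    case True
    have "koszul \<rho> t S = 0" by (rule koszul_support[of "Suc p"]) (auto simp: t(1) True)
    moreover have "c S = 0" by (rule supp) (simp add: True)
    ultimately show ?thesis by simp
  next
    case False
    from t(2)[OF this] show ?thesis by simp
  qed
  with t(1) show ?thesis by blast
qed

text \<open>If the entries and the right-hand side of a solvable linear system are homogeneous of
  matching degrees, then the components of a solution in the appropriate degrees solve it as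
  well.\<close>

lemma homog_lift:
  fixes A :: "nat \<Rightarrow> nat \<Rightarrow> ('v::finite, 'k::comm_ring_1) mpoly"
  assumes "\<And>b c. b < r \<Longrightarrow> c < q \<Longrightarrow> A b c \<in> homog (\<tau> c - \<sigma> b)"
    and "\<And>b. b < r \<Longrightarrow> t b \<in> homog (e - \<sigma> b)"
    and "\<exists>w. \<forall>b<r. t b = (\<Sum>c<q. A b c * w c)"
  shows "\<exists>w. (\<forall>b<r. t b = (\<Sum>c<q. A b c * w c)) \<and> (\<forall>c. w c \<in> homog (e - \<tau> c))"
proof -
  from assms(3) obtain w where w: "\<And>b. b < r \<Longrightarrow> t b = (\<Sum>c<q. A b c * w c)" by blast
  define w' where "w' c = pfilter (\<lambda>m. \<tau> c + int (mon_degree m) = e) (w c)" for c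
  have "t b = (\<Sum>c<q. A b c * w' c)" if b: "b < r" for b
  proof -
    let ?Q = "\<lambda>m. \<sigma> b + int (mon_degree m) = e"
    have "t b = pfilter ?Q (t b)" using assms(2)[OF b] by (intro pfilter_id[symmetric]) (auto dest: homogD)
    also have "\<dots> = (\<Sum>c<q. pfilter ?Q (A b c * w c))" using w[OF b] by (simp add: pfilter_sum)
    also have "\<dots> = (\<Sum>c<q. A b c * w' c)"
      unfolding w'_def
    proof (intro sum.cong refl pfilter_mult)
      fix c k m assume "c \<in> {..<q}" "k \<in> keys (A b c)"
      then have "int (mon_degree k) = \<tau> c - \<sigma> b" using assms(1)[OF b] by (auto dest: homogD)
      then show "\<sigma> b + int (mon_degree (k + m)) = e \<longleftrightarrow> \<tau> c + int (mon_degree m) = e"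
        by (simp add: mon_degree_add)
    qed
    finally show ?thesis .
  qed
  moreover have "w' c \<in> homog (e - \<tau> c)" for c
    by (simp add: w'_def pfilter_homog)
  ultimately show ?thesis by blast
qed

text \<open>Dimension shifting: a class in degree \<open>d\<close> of the Koszul homology \<open>H\<^sub>p\<close> of the \<open>i\<close>-th syzygy
  module injects into \<open>H\<^sub>p\<^sub>-\<^sub>1\<close> of the next one, and \<open>H\<^sub>0\<close> lives only in the degrees of the
  generators.\<close>

lemma koszul_syzygy_boundary:
  fixes n :: "nat \<Rightarrow> nat" and \<sigma> :: "nat \<Rightarrow> nat \<Rightarrow> int"
    and A :: "nat \<Rightarrow> nat \<Rightarrow> nat \<Rightarrow> ('v::finite, 'k::comm_ring_1) mpoly"
  assumes \<rho>: "inj \<rho>"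
    and hom: "\<And>i b c. b < n i \<Longrightarrow> c < n (Suc i) \<Longrightarrow> A i b c \<in> homog (\<sigma> (Suc i) c - \<sigma> i b)"
    and exact: "\<And>i w. (\<forall>b<n i. (\<Sum>c<n (Suc i). A i b c * w c) = 0) \<longleftrightarrow>
      (\<exists>u. \<forall>c<n (Suc i). w c = (\<Sum>e<n (Suc (Suc i)). A (Suc i) c e * u e))"
    and nogen: "\<And>c. c < n (Suc (i + p)) \<Longrightarrow> \<sigma> (Suc (i + p)) c \<noteq> d"
    and im: "\<And>S. \<exists>w. \<forall>b<n i. z b S = (\<Sum>c<n (Suc i). A i b c * w c)"
    and supp: "\<And>b S. b < n i \<Longrightarrow> card S \<noteq> p \<Longrightarrow> z b S = 0"
    and zhom: "\<And>b S. b < n i \<Longrightarrow> z b S \<in> homog (d - int p - \<sigma> i b)"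
    and cyc: "\<And>b S. b < n i \<Longrightarrow> koszul \<rho> (z b) S = 0"
  shows "\<exists>u. (\<forall>S. \<exists>w. \<forall>b<n i. u b S = (\<Sum>c<n (Suc i). A i b c * w c)) \<and>
    (\<forall>b<n i. \<forall>S. card S \<noteq> Suc p \<longrightarrow> u b S = 0) \<and>
    (\<forall>b<n i. \<forall>S. z b S = koszul \<rho> (u b) S)"
  using nogen im supp zhom cyc
proof (induction p arbitrary: i z)
  case 0
  obtain w where w: "\<And>b. b < n i \<Longrightarrow> z b {} = (\<Sum>c<n (Suc i). A i b c * w c)"
    and wh: "\<And>c. w c \<in> homog (d - \<sigma> (Suc i) c)"
    using homog_lift[of "n i" "n (Suc i)" "A i" "\<sigma> (Suc i)" "\<sigma> i" "\<lambda>b. z b {}" d]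
      hom 0(2)[of "{}"] 0(4)[of _ "{}"] by auto
  \<comment> \<open>The degree of \<open>w c\<close> is \<open>d\<close> minus the degree of the
    \<open>c\<close>-th generator; this is not 0 by assumption, so \<open>w c\<close> has no
    constant term.\<close>
  have "\<exists>y. w c = (\<Sum>v\<in>UNIV. var v * y v)" if "c < n (Suc i)" for c
  proof (rule sum_var_mult, rule ccontr)
    assume "lookup (w c) 0 \<noteq> 0"
    then have "0 = d - \<sigma> (Suc i) c" using homogD[OF wh, of 0 c] by (simp add: in_keys_iff)
    with 0(1)[of c] that show False by simp
  qed
  then obtain y where y: "\<And>c. c < n (Suc i) \<Longrightarrow> w c = (\<Sum>v\<in>UNIV. var v * y c v)" by metis
  \<comment> \<open>The 1-chain \<open>V c\<close> has boundary \<open>w c\<close> at the empty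
    set.\<close>
  define V where "V c S = (if card S = Suc 0 then y c (the_elem S) else 0)" for c S
  define u where "u b S = (\<Sum>c<n (Suc i). A i b c * V c S)" for b S
  have supp: "u b S = 0" if "card S \<noteq> Suc 0" for b S using that by (simp add: u_def V_def)
  have "z b S = koszul \<rho> (u b) S" if b: "b < n i" for b S
  proof (cases "S = {}")
    case True
    have "koszul \<rho> (u b) {} = (\<Sum>v\<in>UNIV. var v * u b {v})"
      by (simp add: koszul_def ksign_def)
    also have "\<dots> = (\<Sum>v\<in>UNIV. \<Sum>c<n (Suc i). A i b c * (var v * y c v))"
      by (simp add: u_def V_def sum_distrib_left algebra_simps)
    also have "\<dots> = (\<Sum>c<n (Suc i). A i b c * w c)"
      by (subst sum.swap) (simp add: y sum_distrib_left)
    finally show ?thesis using w[OF b] True by simp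
  next
    case False
    then have "z b S = 0" using 0(3)[OF b] by (simp add: card_eq_0_iff)
    moreover have "koszul \<rho> (u b) S = 0"
      using False by (intro koszul_support[of 0]) (auto simp: supp card_eq_0_iff)
    ultimately show ?thesis by simp
  qed
  moreover have "\<exists>w. \<forall>b<n i. u b S = (\<Sum>c<n (Suc i). A i b c * w c)" for S
    unfolding u_def by (intro exI[of _ "\<lambda>c. V c S"]) simp
  ultimately show ?case using supp by (intro exI[of _ u]) blast
next
  case (Suc p)
  have "\<exists>w. (\<forall>b<n i. z b S = (\<Sum>c<n (Suc i). A i b c * w c)) \<and>
      (\<forall>c. w c \<in> homog (d - int (Suc p) - \<sigma> (Suc i) c))" for S
    using hom Suc(3)[of S] Suc(5)[of _ S] by (intro homog_lift) auto
  then obtain W0 where W0: "\<And>S b. b < n i \<Longrightarrow> z b S = (\<Sum>c<n (Suc i). A i b c * W0 S c)"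
    and W0h: "\<And>S c. W0 S c \<in> homog (d - int (Suc p) - \<sigma> (Suc i) c)" by metis
  \<comment> \<open>A lift of the cycle \<open>z\<close> to a chain over the free module. Lifts are
    chosen separately for each \<open>S\<close>, so those outside homological degree
    \<open>Suc p\<close> have to be reset to 0.\<close>
  define W where "W c S = (if card S = Suc p then W0 S c else 0)" for c S
  have Wz: "z b S = (\<Sum>c<n (Suc i). A i b c * W c S)" if "b < n i" for b S
    using W0[where b = b and S = S] Suc(4)[where b = b and S = S] that by (cases "card S = Suc p") (simp_all add: W_def)
  have Wsupp: "W c S = 0" if "card S \<noteq> Suc p" for c S using that by (simp add: W_def)
  have Wh: "W c S \<in> homog (d - int (Suc p) - \<sigma> (Suc i) c)" for c S
    using W0h by (simp add: W_def)
  \<comment> \<open>The connecting homomorphism: the boundary of the lift is mapped to 0 by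
    \<open>A i\<close>, so by exactness it is a cycle over the next syzygy module, in homological
    degree \<open>p\<close>.\<close>
  define y where "y c = koszul \<rho> (W c)" for c
  have Ay: "(\<Sum>c<n (Suc i). A i b c * y c S) = 0" if "b < n i" for b S
  proof -
    have "(\<Sum>c<n (Suc i). A i b c * y c S) = koszul \<rho> (\<lambda>S. \<Sum>c<n (Suc i). A i b c * W c S) S"
      by (simp add: y_def koszul_linear)
    also have "\<dots> = koszul \<rho> (z b) S" using Wz[OF that] by presburger
    finally show ?thesis using Suc(6)[OF that] by simp
  qed
  have "\<exists>u. (\<forall>S. \<exists>w. \<forall>b<n (Suc i). u b S = (\<Sum>c<n (Suc (Suc i)). A (Suc i) b c * w c)) \<and>
    (\<forall>b<n (Suc i). \<forall>S. card S \<noteq> Suc p \<longrightarrow> u b S = 0) \<and>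
    (\<forall>b<n (Suc i). \<forall>S. y b S = koszul \<rho> (u b) S)"
  proof (rule Suc.IH)
    show "\<And>c. c < n (Suc (Suc i + p)) \<Longrightarrow> \<sigma> (Suc (Suc i + p)) c \<noteq> d" using Suc(2) by simp
    show "\<exists>w. \<forall>b<n (Suc i). y b S = (\<Sum>c<n (Suc (Suc i)). A (Suc i) b c * w c)" for S
      using exact[of i "\<lambda>c. y c S"] Ay by blast
    show "y b S = 0" if "card S \<noteq> p" for b S
      unfolding y_def using Wsupp that by (rule koszul_support)
    show "y b S \<in> homog (d - int p - \<sigma> (Suc i) b)" for b S
      using koszul_homog[where c = "W b" and \<rho> = \<rho> and S = S, OF Wh] by (simp add: y_def algebra_simps)
    show "koszul \<rho> (y b) S = 0" for b S
      unfolding y_def by (rule koszul_koszul[OF \<rho>])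
  qed
  then obtain u where u: "\<And>S. \<exists>w. \<forall>b<n (Suc i). u b S = (\<Sum>c<n (Suc (Suc i)). A (Suc i) b c * w c)"
    "\<And>b S. b < n (Suc i) \<Longrightarrow> card S \<noteq> Suc p \<Longrightarrow> u b S = 0"
    "\<And>b S. b < n (Suc i) \<Longrightarrow> y b S = koszul \<rho> (u b) S" by blast
  have Au: "(\<Sum>c<n (Suc i). A i b c * u c S) = 0" if "b < n i" for b S
    using exact[of i "\<lambda>c. u c S"] u(1)[of S] that by blast
  \<comment> \<open>Since \<open>y\<close> bounds \<open>u\<close>, the difference
    \<open>W - u\<close> is a cycle over a free module and hence a boundary. As \<open>A i\<close>
    kills \<open>u\<close>, applying it to \<open>t\<close> yields a chain with boundary
    \<open>z\<close>.\<close>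
  have "\<exists>t. (\<forall>S. card S \<noteq> Suc (Suc p) \<longrightarrow> t S = 0) \<and> (\<forall>S. W c S - u c S = koszul \<rho> t S)"
    if c: "c < n (Suc i)" for c
    using Wsupp u(2,3)[OF c] by (intro koszul_exact[OF \<rho>]) (auto simp: koszul_diff y_def)
  then obtain t where t: "\<And>c S. c < n (Suc i) \<Longrightarrow> card S \<noteq> Suc (Suc p) \<Longrightarrow> t c S = 0"
    "\<And>c S. c < n (Suc i) \<Longrightarrow> W c S - u c S = koszul \<rho> (t c) S" by metis
  define x where "x b S = (\<Sum>c<n (Suc i). A i b c * t c S)" for b S
  have "z b S = koszul \<rho> (x b) S" if b: "b < n i" for b S
  proof -
    have "koszul \<rho> (x b) S = (\<Sum>c<n (Suc i). A i b c * koszul \<rho> (t c) S)"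
      unfolding x_def by (rule koszul_linear)
    also have "\<dots> = (\<Sum>c<n (Suc i). A i b c * (W c S - u c S))" by (simp add: t(2))
    also have "\<dots> = z b S" using Wz[OF b, of S] Au[OF b, of S] by (simp add: right_diff_distrib sum_subtractf)
    finally show ?thesis ..
  qed
  moreover have "\<exists>w. \<forall>b<n i. x b S = (\<Sum>c<n (Suc i). A i b c * w c)" for S
    unfolding x_def by (intro exI[of _ "\<lambda>c. t c S"]) simp
  moreover have "x b S = 0" if "card S \<noteq> Suc (Suc p)" for b S
    using t(1) that by (simp add: x_def)
  ultimately show ?case by (intro exI[of _ x]) blast
qed

section \<open>Minimal generators of multigraded modules\<close>

lemma nat_seq_incseq_subseq:
  fixes f :: "nat \<Rightarrow> nat"
  shows "\<exists>g. strict_mono g \<and> incseq (\<lambda>n. f (g n))"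
proof -
  obtain g where g: "strict_mono g" "monoseq (\<lambda>n. f (g n))"
    using seq_monosub[of f] by blast
  show ?thesis
  proof (cases "incseq (\<lambda>n. f (g n))")
    case False
    then have dec: "decseq (\<lambda>n. f (g n))" using g(2) by (simp add: monoseq_iff)
    \<comment> \<open>A decreasing sequence of natural numbers is constant from the index of its
      minimum on.\<close>
    obtain N where N: "\<And>n. f (g N) \<le> f (g n)" using ex_has_least_nat[of "\<lambda>_. True" 0 "\<lambda>n. f (g n)"] by blast
    have "f (g (n + N)) = f (g N)" for n
      using N[of "n + N"] decseqD[OF dec, of N "n + N"] by simp
    then have "incseq (\<lambda>n. f (g (n + N)))" by (simp add: incseq_def)
    moreover have "strict_mono (\<lambda>n. g (n + N))" using g(1) by (simp add: strict_mono_def)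
    ultimately show ?thesis by blast
  qed (use g in blast)
qed

lemma seq_incseq_subseq_finite:
  fixes f :: "nat \<Rightarrow> 'v \<Rightarrow> nat"
  assumes "finite A"
  shows "\<exists>g. strict_mono g \<and> (\<forall>v\<in>A. incseq (\<lambda>n. f (g n) v))"
  using assms
proof (induction A rule: finite_induct)
  case empty
  show ?case by (intro exI[of _ id]) (simp add: strict_mono_def)
next
  case (insert u A)
  then obtain g where g: "strict_mono g" "\<And>v. v \<in> A \<Longrightarrow> incseq (\<lambda>n. f (g n) v)" by blast
  obtain h where h: "strict_mono h" "incseq (\<lambda>n. f (g (h n)) u)"
    using nat_seq_incseq_subseq[of "\<lambda>n. f (g n) u"] by blast
  have "incseq (\<lambda>n. f (g (h n)) v)" if "v \<in> A" for v
    using g(2)[OF that] h(1) by (simp add: incseq_def strict_mono_less_eq)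
  moreover have "strict_mono (\<lambda>n. g (h n))" using g(1) h(1) by (simp add: strict_mono_def)
  ultimately show ?case using h(2) by (intro exI[of _ "\<lambda>n. g (h n)"]) simp
qed

text \<open>The set \<open>B\<close> consists of the minimal exponents under divisibility. Descent
  in the degree finds one below each element; infinitely many would contain a coordinatewise
  increasing sequence, hence two distinct comparable ones.\<close>

lemma dickson:
  fixes S :: "('v::finite \<Rightarrow>\<^sub>0 nat) set"
  shows "\<exists>B\<subseteq>S. finite B \<and> (\<forall>a\<in>S. \<exists>b\<in>B. \<exists>c. a = b + c)"
proof -
  define B where "B = {b \<in> S. \<forall>b'\<in>S. \<forall>c. b = b' + c \<longrightarrow> b' = b}"
  have "\<exists>b\<in>B. \<exists>c. a = b + c" if "a \<in> S" for a
    using that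
  proof (induction "mon_degree a" arbitrary: a rule: less_induct)
    case less
    show ?case
    proof (cases "a \<in> B")
      case True
      then show ?thesis by (intro bexI[of _ a] exI[of _ 0]) auto
    next
      case False
      then obtain b' c where b': "b' \<in> S" "a = b' + c" "b' \<noteq> a"
        using less.prems unfolding B_def by blast
      then have "c \<noteq> 0" by auto
      then have "mon_degree b' < mon_degree a"
        using b'(2) mon_degree_eq_0_iff[of c] by (simp add: mon_degree_add)
      from less.hyps[OF this b'(1)] obtain b e where "b \<in> B" "b' = b + e" by blast
      then show ?thesis using b'(2) by (intro bexI[of _ b] exI[of _ "e + c"]) (auto simp: add.assoc)
    qed
  qed
  moreover have "finite B"
  proof (rule ccontr)
    assume "infinite B"
    then obtain f :: "nat \<Rightarrow> _" where f: "inj f" "\<And>n. f n \<in> B"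
      using infinite_countable_subset[of B] by blast
    obtain g where g: "strict_mono g" "\<And>v. incseq (\<lambda>n. lookup (f (g n)) v)"
      using seq_incseq_subseq_finite[of UNIV "\<lambda>n. lookup (f n)"] by auto
    \<comment> \<open>Truncated subtraction is exact here because every coordinate increases along
      \<open>g\<close>.\<close>
    have "f (g 1) = f (g 0) + (f (g 1) - f (g 0))"
      using incseqD[OF g(2), of 0 1] by (intro poly_mapping_eqI) (simp add: lookup_add lookup_minus)
    then have "f (g 0) = f (g 1)" using f(2)[of "g 1"] f(2)[of "g 0"] unfolding B_def by blast
    then have "g 0 = g 1" using f(1) by (simp add: inj_eq)
    then show False using g(1) by (simp add: strict_mono_eq)
  qed
  moreover have "B \<subseteq> S" by (auto simp: B_def)
  ultimately show ?thesis by blast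
qed

section \<open>Multigraded submodules of free modules\<close>

definition mcomp ::
  "(nat \<Rightarrow> 'v \<Rightarrow>\<^sub>0 nat) \<Rightarrow> ('v \<Rightarrow>\<^sub>0 nat) \<Rightarrow> (nat \<Rightarrow> ('v, 'k::comm_ring_1) mpoly) \<Rightarrow> nat \<Rightarrow> ('v, 'k) mpoly" where
  "mcomp \<gamma> \<delta> w = (\<lambda>b. pfilter (\<lambda>m. \<gamma> b + m = \<delta>) (w b))"

definition mhomog ::
  "(nat \<Rightarrow> 'v \<Rightarrow>\<^sub>0 nat) \<Rightarrow> ('v \<Rightarrow>\<^sub>0 nat) \<Rightarrow> (nat \<Rightarrow> ('v, 'k::comm_ring_1) mpoly) \<Rightarrow> bool" where
  "mhomog \<gamma> \<delta> w \<longleftrightarrow> (\<forall>b. \<forall>m\<in>keys (w b). \<gamma> b + m = \<delta>)"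

text \<open>Here \<open>\<gamma> b\<close> is the multidegree of the \<open>b\<close>-th basis
  element of a free module of rank \<open>q\<close>, so a monomial \<open>m\<close> in coordinate
  \<open>b\<close> has multidegree \<open>\<gamma> b + m\<close>.\<close>

definition multigraded_submodule ::
  "nat \<Rightarrow> (nat \<Rightarrow> 'v \<Rightarrow>\<^sub>0 nat) \<Rightarrow> (nat \<Rightarrow> ('v, 'k::comm_ring_1) mpoly) set \<Rightarrow> bool" where
  "multigraded_submodule q \<gamma> N \<longleftrightarrow> fm.subspace N \<and> (\<forall>w\<in>N. \<forall>b\<ge>q. w b = 0) \<and>
     (\<forall>w\<in>N. \<forall>\<delta>. mcomp \<gamma> \<delta> w \<in> N)"

lemma mhomog_mcomp: "mhomog \<gamma> \<delta> (mcomp \<gamma> \<delta> w)"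
  by (simp add: mhomog_def mcomp_def keys_pfilter)

lemma mhomogD: "mhomog \<gamma> \<delta> w \<Longrightarrow> m \<in> keys (w b) \<Longrightarrow> \<gamma> b + m = \<delta>"
  by (simp add: mhomog_def)

lemma mhomog_diff: "mhomog \<gamma> \<delta> w \<Longrightarrow> mhomog \<gamma> \<delta> w' \<Longrightarrow> mhomog \<gamma> \<delta> (w - w')"
  unfolding mhomog_def
proof (intro allI ballI)
  fix b m
  assume *: "\<forall>b. \<forall>m\<in>keys (w b). \<gamma> b + m = \<delta>" "\<forall>b. \<forall>m\<in>keys (w' b). \<gamma> b + m = \<delta>"
    and m: "m \<in> keys ((w - w') b)"
  have "m \<in> keys (w b) \<or> m \<in> keys (w' b)"
    using m by (auto simp: in_keys_iff lookup_minus)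
  then show "\<gamma> b + m = \<delta>" using * by auto
qed

lemma mhomog_fscale: "mhomog \<gamma> \<delta> w \<Longrightarrow> mhomog \<gamma> (\<delta> + c) (fscale (single c k) w)"
  unfolding mhomog_def
proof (intro allI ballI)
  fix b m assume w: "\<forall>b. \<forall>m\<in>keys (w b). \<gamma> b + m = \<delta>" and "m \<in> keys (fscale (single c k) w b)"
  then obtain m' where "m = c + m'" "m' \<in> keys (w b)"
    using keys_mult[of "single c k" "w b"] by (cases "k = 0") auto
  then show "\<gamma> b + m = \<delta> + c" using w by (metis add.assoc add.commute)
qed

lemma mhomog_single:
  assumes "mhomog \<gamma> \<delta> w" "w b \<noteq> 0"
  shows "\<exists>m a. w b = single m a \<and> a \<noteq> 0 \<and> \<gamma> b + m = \<delta>"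
proof -
  obtain m where m: "m \<in> keys (w b)" using assms(2) by (metis equals0I keys_eq_empty)
  have "m' = m" if "m' \<in> keys (w b)" for m'
    using mhomogD[OF assms(1) m] mhomogD[OF assms(1) that] by (metis add_left_cancel)
  then have "w b = single m (lookup (w b) m)"
    by (intro poly_mapping_eqI) (metis in_keys_iff lookup_single_eq lookup_single_not_eq)
  then show ?thesis using m mhomogD[OF assms(1) m] by (auto simp: in_keys_iff)
qed

lemma sum_mcomp:
  assumes "\<forall>b\<ge>q. w b = 0"
  shows "\<exists>D. finite D \<and> w = (\<Sum>\<delta>\<in>D. mcomp \<gamma> \<delta> w)"
proof -
  define D where "D = (\<Union>b<q. (\<lambda>m. \<gamma> b + m) ` keys (w b))"
  have D: "finite D" by (simp add: D_def)
  have app: "(\<Sum>\<delta>\<in>X. mcomp \<gamma> \<delta> w) b = (\<Sum>\<delta>\<in>X. mcomp \<gamma> \<delta> w b)" for X b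
    by (induction X rule: infinite_finite_induct) simp_all
  have "w b = (\<Sum>\<delta>\<in>D. mcomp \<gamma> \<delta> w b)" for b
  proof (cases "b < q")
    case True
    then show ?thesis unfolding mcomp_def using D by (intro sum_pfilter[symmetric]) (auto simp: D_def)
  next
    case False
    then show ?thesis using assms by (simp add: mcomp_def)
  qed
  then have "w = (\<Sum>\<delta>\<in>D. mcomp \<gamma> \<delta> w)" by (intro ext) (simp add: app)
  with D show ?thesis by blast
qed

text \<open>Groebner-style division in which only the position of the last non-zero coordinate has to be
  ordered: a multihomogeneous element has at most one monomial in each coordinate.\<close>

lemma multigraded_finitely_generated:
  fixes N :: "(nat \<Rightarrow> ('v::finite, 'k::field) mpoly) set"
  assumes N: "multigraded_submodule q \<gamma> N"
  shows "\<exists>G. finite G \<and> (\<forall>g\<in>G. \<exists>\<delta>. mhomog \<gamma> \<delta> g) \<and> fm.span G = N"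
proof -
  have sub: "fm.subspace N" and van: "\<And>w b. w \<in> N \<Longrightarrow> q \<le> b \<Longrightarrow> w b = 0"
    and gr: "\<And>w \<delta>. w \<in> N \<Longrightarrow> mcomp \<gamma> \<delta> w \<in> N"
    using N by (auto simp: multigraded_submodule_def)
  \<comment> \<open>The position \<open>b\<close> is that of the last non-zero coordinate. Dickson's
    lemma is applied, for each position, to the multidegrees that occur with it.\<close>
  define lead where "lead b \<delta> w \<longleftrightarrow> w \<in> N \<and> mhomog \<gamma> \<delta> w \<and> w b \<noteq> 0 \<and> (\<forall>b'>b. w b' = 0)"
    for b \<delta> w
  have "\<forall>b. \<exists>B\<subseteq>{\<delta>. \<exists>w. lead b \<delta> w}. finite B \<and> (\<forall>a\<in>{\<delta>. \<exists>w. lead b \<delta> w}. \<exists>\<beta>\<in>B. \<exists>c. a = \<beta> + c)"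
    using dickson by blast
  then obtain B where B: "\<And>b. B b \<subseteq> {\<delta>. \<exists>w. lead b \<delta> w}" "\<And>b. finite (B b)"
    "\<And>b \<delta> w. lead b \<delta> w \<Longrightarrow> \<exists>\<beta>\<in>B b. \<exists>c. \<delta> = \<beta> + c" by (metis mem_Collect_eq)
  define wit where "wit b \<beta> = (SOME w. lead b \<beta> w)" for b \<beta>
  have wit: "lead b \<beta> (wit b \<beta>)" if "\<beta> \<in> B b" for b \<beta>
  proof -
    have "\<exists>w. lead b \<beta> w" using B(1)[of b] that by blast
    then show ?thesis unfolding wit_def by (rule someI_ex)
  qed
  define G where "G = (\<lambda>(b, \<beta>). wit b \<beta>) ` (SIGMA b:{..<q}. B b)"
  have GN: "G \<subseteq> N" and Gh: "\<forall>g\<in>G. \<exists>\<delta>. mhomog \<gamma> \<delta> g" and Gf: "finite G"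
    using wit B(2) by (auto simp: G_def lead_def)
  \<comment> \<open>Induction on a bound for the support: each division step clears the last
    coordinate and keeps the multidegree.\<close>
  have key: "w \<in> fm.span G" if "w \<in> N" "mhomog \<gamma> \<delta> w" "\<forall>b\<ge>k. w b = 0" for k w \<delta>
    using that
  proof (induction k arbitrary: w)
    case 0
    then have "w = 0" by (intro ext) simp
    then show ?case by (simp only: fm.span_zero)
  next
    case (Suc k)
    show ?case
    proof (cases "w k = 0")
      case True
      then have "\<forall>b\<ge>k. w b = 0" using Suc.prems(3) by (metis Suc_leI le_neq_implies_less)
      then show ?thesis using Suc by blast
    next
      case False
      then have "k < q" using van[OF Suc.prems(1)] by (meson not_le)
      have "lead k \<delta> w" using Suc.prems False by (simp add: lead_def)
      then obtain \<beta> c where \<beta>: "\<beta> \<in> B k" "\<delta> = \<beta> + c" using B(3) by blast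
      define g where "g = wit k \<beta>"
      have g: "g \<in> N" "mhomog \<gamma> \<beta> g" "g k \<noteq> 0" "\<forall>b>k. g b = 0"
        using wit[OF \<beta>(1)] by (auto simp: lead_def g_def)
      have gG: "g \<in> G" using \<beta>(1) \<open>k < q\<close> by (force simp: G_def g_def)
      obtain m a where m: "w k = single m a" "\<gamma> k + m = \<delta>" using mhomog_single[OF Suc.prems(2) False] by blast
      obtain m' a' where m': "g k = single m' a'" "a' \<noteq> 0" "\<gamma> k + m' = \<beta>" using mhomog_single[OF g(2,3)] by blast
      have "m = c + m'" using m(2) m'(3) \<beta>(2) by (metis add.assoc add.commute add_left_cancel)
      \<comment> \<open>Both leading coordinates are single terms, and their exponents differ by
        \<open>c\<close>; dividing \<open>a\<close> by \<open>a'\<close> in the field makes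
        coordinate \<open>k\<close> cancel.\<close>
      define w' where "w' = w - fscale (single c (a / a')) g"
      have "w' k = 0" using \<open>m = c + m'\<close> m(1) m'(1,2) by (simp add: w'_def mult_single)
      then have "w' b = 0" if "k \<le> b" for b
        using that Suc.prems(3) g(4) by (cases "b = k") (simp_all add: w'_def)
      moreover have "mhomog \<gamma> \<delta> w'"
        unfolding w'_def \<beta>(2) by (intro mhomog_diff mhomog_fscale g(2)) (use Suc.prems(2) \<beta>(2) in simp)
      moreover have "w' \<in> N"
        unfolding w'_def by (intro fm.subspace_diff fm.subspace_scale sub g(1) Suc.prems(1))
      ultimately have "w' \<in> fm.span G" using Suc.IH by blast
      then have "w' + fscale (single c (a / a')) g \<in> fm.span G"
        by (rule fm.span_add[OF _ fm.span_scale[OF fm.span_base[OF gG]]])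
      then show ?thesis by (simp only: w'_def diff_add_cancel)
    qed
  qed
  have "w \<in> fm.span G" if w: "w \<in> N" for w
  proof -
    obtain D where D: "w = (\<Sum>\<delta>\<in>D. mcomp \<gamma> \<delta> w)"
      using sum_mcomp[of q w \<gamma>] van[OF w] by blast
    have "mcomp \<gamma> \<delta> w \<in> fm.span G" for \<delta>
      using key[OF gr[OF w] mhomog_mcomp, of q] van[OF gr[OF w]] by blast
    then show ?thesis by (subst D) (rule fm.span_sum)
  qed
  then have "fm.span G = N" using fm.span_minimal[OF GN sub] by blast
  with Gf Gh show ?thesis by blast
qed

lemma fun_sum_apply: "(\<Sum>i\<in>A. f i) b = (\<Sum>i\<in>A. f i b)"
  by (induction A rule: infinite_finite_induct) simp_all

text \<open>The columns of \<open>A\<close> form a homogeneous generating set of least cardinality.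
  A relation with a non-zero constant term in some coefficient would express that generator by the
  others.\<close>

lemma multigraded_minimal_generators:
  fixes N :: "(nat \<Rightarrow> ('v::finite, 'k::field) mpoly) set"
  assumes N: "multigraded_submodule q \<gamma> N"
  shows "\<exists>(q'::nat) \<gamma>' A. (\<forall>c<q'. mhomog \<gamma> (\<gamma>' c) (\<lambda>b. A b c)) \<and>
    (\<forall>w. w \<in> N \<longleftrightarrow> (\<exists>u. \<forall>b. w b = (\<Sum>c<q'. A b c * u c))) \<and>
    (\<forall>u. (\<forall>b<q. (\<Sum>c<q'. A b c * u c) = 0) \<longrightarrow> (\<forall>c<q'. lookup (u c) 0 = 0))"
proof -
  let ?P = "\<lambda>G. finite G \<and> (\<forall>g\<in>G. \<exists>\<delta>. mhomog \<gamma> \<delta> g) \<and> fm.span G = N"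
  obtain G0 where "?P G0" using multigraded_finitely_generated[OF N] by blast
  then have "\<exists>G. ?P G \<and> (\<forall>H. ?P H \<longrightarrow> card G \<le> card H)" by (rule ex_has_least_nat)
  then obtain G where G: "finite G" "\<And>g. g \<in> G \<Longrightarrow> \<exists>\<delta>. mhomog \<gamma> \<delta> g" "fm.span G = N"
    and min: "\<And>H. ?P H \<Longrightarrow> card G \<le> card H"
    by blast
  obtain dg where dg: "\<And>g. g \<in> G \<Longrightarrow> mhomog \<gamma> (dg g) g" using G(2) by metis
  have minrel: "lookup (u g0) 0 = 0" if rel: "(\<Sum>g\<in>G. fscale (u g) g) = 0" and g0: "g0 \<in> G" for u g0
  proof (rule ccontr)
    assume nz: "lookup (u g0) 0 \<noteq> 0"
    \<comment> \<open>The part of the relation in the multidegree of \<open>g0\<close> is again a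
      relation.\<close>
    define u' where "u' g = pfilter (\<lambda>m. dg g + m = dg g0) (u g)" for g
    have rel': "(\<Sum>g\<in>G. fscale (u' g) g) = 0"
    proof
      fix b
      have "0 = pfilter (\<lambda>m. \<gamma> b + m = dg g0) (\<Sum>g\<in>G. g b * u g)"
        using fun_cong[OF rel, of b] by (simp add: fun_sum_apply mult.commute)
      also have "\<dots> = (\<Sum>g\<in>G. pfilter (\<lambda>m. \<gamma> b + m = dg g0) (g b * u g))"
        by (rule pfilter_sum)
      also have "\<dots> = (\<Sum>g\<in>G. g b * u' g)"
        unfolding u'_def
      proof (intro sum.cong refl pfilter_mult)
        fix g k m assume "g \<in> G" "k \<in> keys (g b)"
        then have "\<gamma> b + k = dg g" using dg mhomogD by blast
        then show "\<gamma> b + (k + m) = dg g0 \<longleftrightarrow> dg g + m = dg g0" by (metis add.assoc)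
      qed
      finally show "(\<Sum>g\<in>G. fscale (u' g) g) b = 0 b" by (simp add: fun_sum_apply mult.commute)
    qed
    \<comment> \<open>Only the exponent 0 keeps the multidegree of \<open>g0\<close>, so this
      coefficient is a non-zero constant and can be inverted.\<close>
    have "u' g0 = single 0 (lookup (u g0) 0)"
      by (rule poly_mapping_eqI) (auto simp: u'_def lookup_pfilter lookup_single when_def)
    then have "single 0 (1 / lookup (u g0) 0) * u' g0 = 1"
      using nz by (simp add: mult_single)
    then have "g0 = fscale (single 0 (1 / lookup (u g0) 0)) (fscale (u' g0) g0)"
      by (intro ext) (simp add: mult.assoc[symmetric])
    also have "fscale (u' g0) g0 = - (\<Sum>g\<in>G - {g0}. fscale (u' g) g)"
      using rel' G(1) g0 by (simp add: sum.remove eq_neg_iff_add_eq_0)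
    also have "fscale (single 0 (1 / lookup (u g0) 0)) \<dots> \<in> fm.span (G - {g0})"
      by (intro fm.span_scale fm.span_neg fm.span_sum fm.span_base)
    finally have "g0 \<in> fm.span (G - {g0})" .
    then have "G \<subseteq> fm.span (G - {g0})" by (auto intro: fm.span_base)
    then have "fm.span (G - {g0}) = N"
      using G(3) fm.span_eq[of "G - {g0}" G] fm.span_superset[of G] by blast
    then have "card G \<le> card (G - {g0})" using G(1,2) by (intro min) auto
    then show False using G(1) g0 by (metis card_Diff1_less not_le)
  qed
  obtain h where h: "bij_betw h {..<card G} G"
    using G(1) by (metis ex_bij_betw_nat_finite lessThan_atLeast0)
  define A where "A b c = h c b" for b c
  have hG: "h c \<in> G" if "c < card G" for c using h that by (auto simp: bij_betw_def)
  have A: "(\<Sum>c<card G. A b c * u c) = (\<Sum>g\<in>G. fscale (u (inv_into {..<card G} h g)) g) b" for b u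
  proof -
    have "(\<Sum>c<card G. A b c * u c) = (\<Sum>c<card G. h c b * u (inv_into {..<card G} h (h c)))"
      using h by (intro sum.cong) (auto simp: A_def bij_betw_def)
    also have "\<dots> = (\<Sum>g\<in>G. g b * u (inv_into {..<card G} h g))"
      by (rule sum.reindex_bij_betw[OF h])
    finally show ?thesis by (simp add: fun_sum_apply mult.commute)
  qed
  have A': "(\<Sum>g\<in>G. fscale (u g) g) b = (\<Sum>c<card G. A b c * u (h c))" for b u
  proof -
    have "(\<Sum>c<card G. h c b * u (h c)) = (\<Sum>g\<in>G. g b * u g)"
      by (rule sum.reindex_bij_betw[OF h])
    then show ?thesis by (simp add: A_def fun_sum_apply mult.commute)
  qed
  have "mhomog \<gamma> (dg (h c)) (\<lambda>b. A b c)" if "c < card G" for c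
    using dg[OF hG[OF that]] by (simp add: A_def)
  moreover have "w \<in> N \<longleftrightarrow> (\<exists>u. \<forall>b. w b = (\<Sum>c<card G. A b c * u c))" for w
  proof
    assume "w \<in> N"
    then obtain u where "w = (\<Sum>g\<in>G. fscale (u g) g)"
      using G(3) fm.span_finite[OF G(1)] by auto
    then show "\<exists>u. \<forall>b. w b = (\<Sum>c<card G. A b c * u c)"
      using A' by (intro exI[of _ "\<lambda>c. u (h c)"]) simp
  next
    assume "\<exists>u. \<forall>b. w b = (\<Sum>c<card G. A b c * u c)"
    then obtain u where "\<And>b. w b = (\<Sum>c<card G. A b c * u c)" by blast
    then have "w = (\<Sum>g\<in>G. fscale (u (inv_into {..<card G} h g)) g)"
      by (intro ext) (simp add: A)
    then show "w \<in> N" using G(3) fm.span_finite[OF G(1)] by auto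
  qed
  moreover have "lookup (u c) 0 = 0" if u: "\<forall>b<q. (\<Sum>c<card G. A b c * u c) = 0" and c: "c < card G" for u c
  proof -
    let ?u = "\<lambda>g. u (inv_into {..<card G} h g)"
    have "(\<Sum>g\<in>G. fscale (?u g) g) = 0"
    proof
      fix b
      show "(\<Sum>g\<in>G. fscale (?u g) g) b = 0 b"
      proof (cases "b < q")
        case True
        then show ?thesis using u by (simp add: A[symmetric])
      next
        case False
        \<comment> \<open>All elements of \<open>N\<close> vanish from coordinate \<open>q\<close>
          on, so a relation among the first \<open>q\<close> rows is a full relation.\<close>
        then have "g b = 0" if "g \<in> G" for g
          using that N G(3) fm.span_base[OF that] by (auto simp: multigraded_submodule_def)
        then have "(\<Sum>g\<in>G. ?u g * g b) = 0" by (intro sum.neutral) (metis mult_zero_right)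
        then show ?thesis by (simp add: fun_sum_apply)
      qed
    qed
    from minrel[OF this hG[OF c]] show ?thesis using h c by (simp add: bij_betw_def)
  qed
  ultimately show ?thesis
    by (intro exI[of _ "card G"] exI[of _ "\<lambda>c. dg (h c)"] exI[of _ A]) blast
qed

text \<open>Multihomogeneous columns make the matrix respect multidegrees, so each component of a
  kernel element lies in the kernel. This is what lets a resolution be continued.\<close>

lemma monomial_matrix_kernel:
  fixes A :: "nat \<Rightarrow> nat \<Rightarrow> ('v::finite, 'k::field) mpoly"
  assumes "\<And>b. b < q \<Longrightarrow> mhomog \<alpha> (\<gamma> b) (\<lambda>a. A a b)"
  shows "multigraded_submodule q \<gamma> {w. (\<forall>b\<ge>q. w b = 0) \<and> (\<forall>a<r. (\<Sum>b<q. A a b * w b) = 0)}"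
  unfolding multigraded_submodule_def
proof (intro conjI ballI allI)
  let ?N = "{w. (\<forall>b\<ge>q. w b = 0) \<and> (\<forall>a<r. (\<Sum>b<q. A a b * w b) = 0)}"
  show "fm.subspace ?N"
  proof (rule fm.subspaceI)
    fix c w assume "w \<in> ?N"
    moreover have "(\<Sum>b<q. A a b * (c * w b)) = c * (\<Sum>b<q. A a b * w b)" for a
      by (simp add: sum_distrib_left algebra_simps)
    ultimately show "fscale c w \<in> ?N" by simp
  qed (simp_all add: distrib_left sum.distrib)
  fix w assume w: "w \<in> ?N"
  fix \<delta>
  have "(\<Sum>b<q. A a b * mcomp \<gamma> \<delta> w b) = 0" if "a < r" for a
  proof -
    have "0 = pfilter (\<lambda>m. \<alpha> a + m = \<delta>) (\<Sum>b<q. A a b * w b)" using w that by simp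
    also have "\<dots> = (\<Sum>b<q. pfilter (\<lambda>m. \<alpha> a + m = \<delta>) (A a b * w b))" by (rule pfilter_sum)
    also have "\<dots> = (\<Sum>b<q. A a b * mcomp \<gamma> \<delta> w b)"
      unfolding mcomp_def
    proof (intro sum.cong refl pfilter_mult)
      fix b k m assume "b \<in> {..<q}" "k \<in> keys (A a b)"
      then have "\<alpha> a + k = \<gamma> b" using mhomogD[OF assms] by blast
      then show "\<alpha> a + (k + m) = \<delta> \<longleftrightarrow> \<gamma> b + m = \<delta>" by (metis add.assoc)
    qed
    finally show ?thesis ..
  qed
  with w show "mcomp \<gamma> \<delta> w \<in> ?N" by (simp add: mcomp_def)
qed simp

section \<open>Monomial ideals\<close>

definition monomial_ideal :: "('v, 'k::comm_ring_1) mpoly set \<Rightarrow> bool" where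
  "monomial_ideal J \<longleftrightarrow> idl.subspace J \<and> (\<forall>p\<in>J. \<forall>m\<in>keys p. single m 1 \<in> J)"

text \<open>The generators themselves may be arbitrary polynomials, so that the set of products
  defining \<open>ideal_power\<close> is covered. A monomial of a combination is a multiple of a
  monomial of some generator.\<close>

lemma monomial_ideal_gen:
  assumes "\<And>p m. p \<in> S \<Longrightarrow> m \<in> keys p \<Longrightarrow> single m 1 \<in> ideal_gen S"
  shows "monomial_ideal (ideal_gen S)"
proof -
  have "single m 1 \<in> idl.span S" if "p \<in> idl.span S" "m \<in> keys p" for p m
    using that
  proof (induction p arbitrary: m rule: idl.span_induct_alt)
    case (step c x y)
    then consider "m \<in> keys (c * x)" | "m \<in> keys y" using keys_add[of "c * x" y] by blast
    then show ?case
    proof cases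
      case 1
      then obtain i j where ij: "m = i + j" "i \<in> keys c" "j \<in> keys x" using keys_mult[of c x] by blast
      then have "single i 1 * single j 1 \<in> idl.span S"
        using assms[OF step(1)] by (intro idl.span_scale) (simp add: ideal_gen_def)
      then show ?thesis using ij by (simp add: mult_single)
    qed (use step in blast)
  qed simp
  then show ?thesis by (simp add: monomial_ideal_def ideal_gen_def)
qed

lemma monomial_ideal_edge_ideal: "monomial_ideal (edge_ideal E :: ('v::finite, 'k::comm_ring_1) mpoly set)"
  unfolding edge_ideal_def
proof (rule monomial_ideal_gen)
  fix p :: "('v, 'k) mpoly" and m
  let ?S = "{var u * var v |u v. {u, v} \<in> E} :: ('v, 'k) mpoly set"
  assume p: "p \<in> ?S" and m: "m \<in> keys p"
  obtain n where n: "p = single n 1" using p by (auto simp: var_def mult_single)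
  then have "single m 1 = p" using m by (simp split: if_splits)
  then show "single m 1 \<in> ideal_gen ?S" using p by (metis (no_types, lifting) ideal_gen_def idl.span_base)
qed

lemma monomial_ideal_power:
  assumes "monomial_ideal I"
  shows "monomial_ideal (ideal_power I s)"
proof (induction s)
  case 0
  show ?case by (simp add: monomial_ideal_def)
next
  case (Suc s)
  let ?S = "{a * b | a b. a \<in> I \<and> b \<in> ideal_power I s}"
  have "monomial_ideal (ideal_gen ?S)"
  proof (rule monomial_ideal_gen)
    fix p m assume p: "p \<in> ?S" and m: "m \<in> keys p"
    then obtain a b where ab: "p = a * b" "a \<in> I" "b \<in> ideal_power I s" by blast
    then obtain i j where ij: "m = i + j" "i \<in> keys a" "j \<in> keys b" using m keys_mult[of a b] by blast
    have "single i 1 \<in> I" "single j 1 \<in> ideal_power I s"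
      using ab ij assms Suc.IH unfolding monomial_ideal_def by blast+
    then have "single i 1 * single j 1 \<in> ?S" by blast
    then have "single i 1 * single j 1 \<in> ideal_gen ?S" unfolding ideal_gen_def by (rule idl.span_base)
    then show "single m 1 \<in> ideal_gen ?S" using ij(1) by (simp add: mult_single)
  qed
  then show ?case by simp
qed

lemma pfilter_monomial_ideal:
  assumes "monomial_ideal J" "p \<in> J"
  shows "pfilter P p \<in> J"
proof -
  have "single 0 (lookup p m) * single m 1 \<in> J" if "m \<in> keys p" for m
    using assms that by (intro idl.subspace_scale) (auto simp: monomial_ideal_def)
  then show ?thesis unfolding pfilter_def
    using assms by (intro idl.subspace_sum) (auto simp: monomial_ideal_def mult_single)
qed

text \<open>The ideal is viewed as a submodule of the free module of rank one generated in
  multidegree 0; this starts the resolution.\<close>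

lemma multigraded_submodule_monomial_ideal:
  assumes "monomial_ideal J"
  shows "multigraded_submodule 1 (\<lambda>_. 0) {w. w 0 \<in> J \<and> (\<forall>b\<ge>1. w b = 0)}"
  using assms
  by (auto simp: multigraded_submodule_def mcomp_def pfilter_monomial_ideal monomial_ideal_def
      idl.subspace_0 idl.subspace_add idl.subspace_scale intro!: fm.subspaceI)

text \<open>One step of the resolution, as \<open>(r, q, \<gamma>, A)\<close>: a matrix \<open>A\<close> with \<open>r\<close> rows and \<open>q\<close> columns of
  multidegrees \<open>\<gamma>\<close> that minimally generate its image.\<close>

definition minimal_step ::
  "nat \<times> nat \<times> (nat \<Rightarrow> 'v \<Rightarrow>\<^sub>0 nat) \<times> (nat \<Rightarrow> nat \<Rightarrow> ('v, 'k::comm_ring_1) mpoly) \<Rightarrow> bool" where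
  "minimal_step = (\<lambda>(r, q, \<gamma>, A). (\<exists>\<alpha>. \<forall>c<q. mhomog \<alpha> (\<gamma> c) (\<lambda>b. A b c)) \<and>
     (\<forall>u. (\<forall>b<r. (\<Sum>c<q. A b c * u c) = 0) \<longrightarrow> (\<forall>c<q. lookup (u c) 0 = 0)))"

definition next_step ::
  "nat \<times> nat \<times> (nat \<Rightarrow> 'v \<Rightarrow>\<^sub>0 nat) \<times> (nat \<Rightarrow> nat \<Rightarrow> ('v, 'k::comm_ring_1) mpoly) \<Rightarrow>
   nat \<times> nat \<times> (nat \<Rightarrow> 'v \<Rightarrow>\<^sub>0 nat) \<times> (nat \<Rightarrow> nat \<Rightarrow> ('v, 'k) mpoly) \<Rightarrow> bool" where
  "next_step = (\<lambda>(r, q, \<gamma>, A) (r', q', \<gamma>', A'). r' = q \<and>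
     (\<forall>c<q'. mhomog \<gamma> (\<gamma>' c) (\<lambda>b. A' b c)) \<and>
     (\<forall>w. (\<forall>a<r. (\<Sum>b<q. A a b * w b) = 0) \<longleftrightarrow> (\<exists>u. \<forall>b<q. w b = (\<Sum>c<q'. A' b c * u c))))"

text \<open>The kernel of the present matrix is multigraded, and its minimal generators become the
  columns of the next one.\<close>

lemma minimal_step_next:
  fixes X :: "nat \<times> nat \<times> (nat \<Rightarrow> 'v::finite \<Rightarrow>\<^sub>0 nat) \<times> (nat \<Rightarrow> nat \<Rightarrow> ('v, 'k::field) mpoly)"
  assumes "minimal_step X"
  shows "\<exists>Y. minimal_step Y \<and> next_step X Y"
proof -
  obtain r q \<gamma> A where X: "X = (r, q, \<gamma>, A)" by (metis prod_cases4)
  obtain \<alpha> where "\<And>c. c < q \<Longrightarrow> mhomog \<alpha> (\<gamma> c) (\<lambda>b. A b c)"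
    using assms by (auto simp: X minimal_step_def)
  let ?N = "{w. (\<forall>b\<ge>q. w b = 0) \<and> (\<forall>a<r. (\<Sum>b<q. A a b * w b) = 0)}"
  have "multigraded_submodule q \<gamma> ?N" by (rule monomial_matrix_kernel) fact
  from multigraded_minimal_generators[OF this] obtain q' :: nat and \<gamma>' A' where
    h: "\<And>c. c < q' \<Longrightarrow> mhomog \<gamma> (\<gamma>' c) (\<lambda>b. A' b c)" and
    g: "\<And>w. w \<in> ?N \<longleftrightarrow> (\<exists>u. \<forall>b. w b = (\<Sum>c<q'. A' b c * u c))" and
    m: "\<And>u. \<forall>b<q. (\<Sum>c<q'. A' b c * u c) = 0 \<Longrightarrow> \<forall>c<q'. lookup (u c) 0 = 0" by blast
  have "(\<forall>a<r. (\<Sum>b<q. A a b * w b) = 0) \<longleftrightarrow> (\<exists>u. \<forall>b<q. w b = (\<Sum>c<q'. A' b c * u c))" for w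
  proof
    assume "\<forall>a<r. (\<Sum>b<q. A a b * w b) = 0"
    \<comment> \<open>Only the first \<open>q\<close> coordinates of \<open>w\<close> matter; the
      others are set to 0 so that it belongs to the submodule.\<close>
    then have "(\<lambda>b. if b < q then w b else 0) \<in> ?N" by simp
    then show "\<exists>u. \<forall>b<q. w b = (\<Sum>c<q'. A' b c * u c)" unfolding g by metis
  next
    assume "\<exists>u. \<forall>b<q. w b = (\<Sum>c<q'. A' b c * u c)"
    then obtain u where u: "\<And>b. b < q \<Longrightarrow> w b = (\<Sum>c<q'. A' b c * u c)" by blast
    have "(\<lambda>b. \<Sum>c<q'. A' b c * u c) \<in> ?N" unfolding g by blast
    then show "\<forall>a<r. (\<Sum>b<q. A a b * w b) = 0" using u by simp
  qed
  then have "next_step X (q, q', \<gamma>', A')" using h by (simp add: X next_step_def)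
  moreover have "minimal_step (q, q', \<gamma>', A')" using h m by (auto simp: minimal_step_def)
  ultimately show ?thesis by blast
qed

section \<open>Existence of minimal graded free resolutions\<close>

text \<open>The numbering is moved up by one: the ring itself, of rank 1 and shift 0, takes position
  0, and the augmentation becomes the matrix number 0. The free module in homological degree
  \<open>i\<close> is then at position \<open>Suc i\<close>.\<close>

definition res_rank :: "('r, 'm) free_res \<Rightarrow> nat \<Rightarrow> nat" where
  "res_rank F i = (case i of 0 \<Rightarrow> 1 | Suc j \<Rightarrow> rk F j)"

definition res_shift :: "('r, 'm) free_res \<Rightarrow> nat \<Rightarrow> nat \<Rightarrow> int" where
  "res_shift F i b = (case i of 0 \<Rightarrow> 0 | Suc j \<Rightarrow> shift F j b)"

definition res_entry :: "('r, 'r) free_res \<Rightarrow> nat \<Rightarrow> nat \<Rightarrow> nat \<Rightarrow> 'r" where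
  "res_entry F i a b = (case i of 0 \<Rightarrow> aug F b | Suc j \<Rightarrow> bd F j $$ (a, b))"

lemmas res_simps = res_rank_def res_shift_def res_entry_def

section \<open>From matrices and vectors to functions\<close>

lemma mult_mat_vec_eq_iff:
  fixes A :: "'r::comm_ring_1 mat"
  assumes "A \<in> carrier_mat r q" "w \<in> carrier_vec q" "v \<in> carrier_vec r"
  shows "v = A *\<^sub>v w \<longleftrightarrow> (\<forall>a<r. v $ a = (\<Sum>b<q. A $$ (a, b) * w $ b))"
proof -
  have "(A *\<^sub>v w) $ a = (\<Sum>b<q. A $$ (a, b) * w $ b)" if "a < r" for a
    using assms that by (auto simp: scalar_prod_def lessThan_atLeast0 intro!: sum.cong)
  then show ?thesis using assms by (auto simp: vec_eq_iff)
qed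

lemma vec_in_image_iff:
  fixes A :: "'r::comm_ring_1 mat"
  assumes "A \<in> carrier_mat r q"
  shows "vec r w \<in> (*\<^sub>v) A ` carrier_vec q \<longleftrightarrow> (\<exists>u. \<forall>a<r. w a = (\<Sum>b<q. A $$ (a, b) * u b))"
proof
  assume "vec r w \<in> (*\<^sub>v) A ` carrier_vec q"
  then obtain u where "u \<in> carrier_vec q" "vec r w = A *\<^sub>v u" by blast
  then have "\<forall>a<r. w a = (\<Sum>b<q. A $$ (a, b) * u $ b)"
    using mult_mat_vec_eq_iff[OF assms] by force
  then show "\<exists>u. \<forall>a<r. w a = (\<Sum>b<q. A $$ (a, b) * u b)" by blast
next
  assume "\<exists>u. \<forall>a<r. w a = (\<Sum>b<q. A $$ (a, b) * u b)"
  then obtain u where "\<forall>a<r. w a = (\<Sum>b<q. A $$ (a, b) * u b)" by blast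
  then have "vec r w = A *\<^sub>v vec q u"
    using mult_mat_vec_eq_iff[OF assms, of "vec q u" "vec r w"] by simp
  then show "vec r w \<in> (*\<^sub>v) A ` carrier_vec q" by simp
qed

lemma vec_in_kernel_iff:
  fixes A :: "'r::comm_ring_1 mat"
  assumes "A \<in> carrier_mat r q"
  shows "vec q w \<in> mat_kernel A \<longleftrightarrow> (\<forall>a<r. (\<Sum>b<q. A $$ (a, b) * w b) = 0)"
  using mult_mat_vec_eq_iff[OF assms, of "vec q w" "0\<^sub>v r"] unfolding mat_kernel[OF assms] by auto

lemma carrier_vec_set_eq_iff:
  assumes "X \<subseteq> carrier_vec q" "Y \<subseteq> carrier_vec q"
  shows "X = Y \<longleftrightarrow> (\<forall>w. vec q w \<in> X \<longleftrightarrow> vec q w \<in> Y)"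
proof -
  have "\<exists>w. v = vec q w" if "v \<in> carrier_vec q" for v :: "'a vec"
    using that by (intro exI[of _ "($) v"]) auto
  then show ?thesis using assms by blast
qed

text \<open>In the new numbering, the conditions on the augmentation and those on the differentials
  merge into one family for homogeneity and one for exactness. Minimality still concerns only the
  differentials.\<close>

lemma minimal_graded_free_resolution_iff:
  fixes J :: "('v::finite, 'k::comm_ring_1) mpoly set"
  shows "minimal_graded_free_resolution (*) homog J F \<longleftrightarrow>
    (\<forall>i. bd F i \<in> carrier_mat (rk F i) (rk F (Suc i))) \<and>
    (\<forall>i. \<forall>a<res_rank F i. \<forall>b<res_rank F (Suc i).
       res_entry F i a b \<in> homog (res_shift F (Suc i) b - res_shift F i a)) \<and>
    (\<forall>p. p \<in> J \<longleftrightarrow> (\<exists>u. p = (\<Sum>b<res_rank F 1. res_entry F 0 0 b * u b))) \<and>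
    (\<forall>i w. (\<forall>a<res_rank F i. (\<Sum>b<res_rank F (Suc i). res_entry F i a b * w b) = 0) \<longleftrightarrow>
       (\<exists>u. \<forall>b<res_rank F (Suc i). w b = (\<Sum>c<res_rank F (Suc (Suc i)). res_entry F (Suc i) b c * u c))) \<and>
    (\<forall>i. \<forall>a<res_rank F (Suc i). \<forall>b<res_rank F (Suc (Suc i)). res_entry F (Suc i) a b \<in> irrelevant_ideal)"
    (is "_ \<longleftrightarrow> ?C \<and> ?H \<and> ?J \<and> ?E \<and> ?M")
proof (cases ?C)
  case True
  then have C: "bd F i \<in> carrier_mat (rk F i) (rk F (Suc i))" for i by blast
  \<comment> \<open>Index 0 accounts for the augmentation, the successors for the
    differentials.\<close>
  have nat_split: "(\<forall>n. P n) \<longleftrightarrow> P 0 \<and> (\<forall>n. P (Suc n))" for P :: "nat \<Rightarrow> bool"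
    by (metis not0_implies_Suc)
  have H: "?H \<longleftrightarrow> (\<forall>b<rk F 0. aug F b \<in> homog (shift F 0 b)) \<and>
      (\<forall>i. \<forall>a<rk F i. \<forall>b<rk F (Suc i). bd F i $$ (a, b) \<in> homog (shift F (Suc i) b - shift F i a))"
    by (subst nat_split) (simp add: res_simps)
  have aug: "aug_map (*) F (vec (rk F 0) u) = (\<Sum>b<rk F 0. aug F b * u b)" for u
    by (simp add: aug_map_def mult.commute)
  have vec: "\<exists>u. v = vec (rk F 0) u" if "v \<in> carrier_vec (rk F 0)" for v :: "('v, 'k) mpoly vec"
    using that by (intro exI[of _ "($) v"]) auto
  have "p \<in> aug_map (*) F ` carrier_vec (rk F 0) \<longleftrightarrow> (\<exists>u. p = (\<Sum>b<rk F 0. aug F b * u b))" for p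
    using aug vec by (metis (no_types, lifting) image_iff vec_carrier)
  then have J: "?J \<longleftrightarrow> aug_map (*) F ` carrier_vec (rk F 0) = J"
    by (simp add: res_simps set_eq_iff) metis
  have "{w \<in> carrier_vec (rk F 0). aug_map (*) F w = 0} = (*\<^sub>v) (bd F 0) ` carrier_vec (rk F 1) \<longleftrightarrow>
      (\<forall>w. (\<Sum>b<rk F 0. aug F b * w b) = 0 \<longleftrightarrow>
        (\<exists>u. \<forall>b<rk F 0. w b = (\<Sum>c<rk F 1. bd F 0 $$ (b, c) * u c)))"
    using C[of 0] vec_in_image_iff[OF C[of 0]] aug by (subst carrier_vec_set_eq_iff[of _ "rk F 0"]) auto
  moreover have "mat_kernel (bd F i) = (*\<^sub>v) (bd F (Suc i)) ` carrier_vec (rk F (Suc (Suc i))) \<longleftrightarrow>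
      (\<forall>w. (\<forall>a<rk F i. (\<Sum>b<rk F (Suc i). bd F i $$ (a, b) * w b) = 0) \<longleftrightarrow>
        (\<exists>u. \<forall>b<rk F (Suc i). w b = (\<Sum>c<rk F (Suc (Suc i)). bd F (Suc i) $$ (b, c) * u c)))" for i
    using mat_kernel_carrier[OF C[of i]] C[of "Suc i"]
    by (subst carrier_vec_set_eq_iff[of _ "rk F (Suc i)"])
      (auto simp: vec_in_image_iff[OF C[of "Suc i"]] vec_in_kernel_iff[OF C[of i]])
  ultimately have E: "?E \<longleftrightarrow> {w \<in> carrier_vec (rk F 0). aug_map (*) F w = 0} = (*\<^sub>v) (bd F 0) ` carrier_vec (rk F 1) \<and>
      (\<forall>i. mat_kernel (bd F i) = (*\<^sub>v) (bd F (Suc i)) ` carrier_vec (rk F (Suc (Suc i))))"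
    by (subst nat_split) (simp add: res_simps)
  have M: "?M \<longleftrightarrow> (\<forall>i. \<forall>a<rk F i. \<forall>b<rk F (Suc i). bd F i $$ (a, b) \<in> irrelevant_ideal)"
    by (simp add: res_simps)
  show ?thesis
    unfolding minimal_graded_free_resolution_def H J E M
    by (rule iffI; elim conjE; intro conjI; assumption)
next
  case False
  then show ?thesis by (auto simp: minimal_graded_free_resolution_def)
qed

text \<open>Iterating \<open>minimal_step_next\<close> by dependent choice from minimal generators
  of \<open>J\<close> gives an exact sequence; its multidegrees are then coarsened to total
  degrees.\<close>

lemma minimal_graded_free_resolution_exists:
  fixes J :: "('v::finite, 'k::field) mpoly set"
  assumes "monomial_ideal J"
  shows "\<exists>F. minimal_graded_free_resolution (*) homog J F"
proof -
  let ?N = "{w. w 0 \<in> J \<and> (\<forall>b\<ge>1. w b = 0)}"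
  obtain q0 :: nat and \<gamma>0 A0 where
    h0: "\<And>c. c < q0 \<Longrightarrow> mhomog (\<lambda>_. 0) (\<gamma>0 c) (\<lambda>b. A0 b c)" and
    g0: "\<And>w. w \<in> ?N \<longleftrightarrow> (\<exists>u. \<forall>b. w b = (\<Sum>c<q0. A0 b c * u c))" and
    m0: "\<And>u. \<forall>b<1. (\<Sum>c<q0. A0 b c * u c) = 0 \<Longrightarrow> \<forall>c<q0. lookup (u c) 0 = 0"
    using multigraded_minimal_generators[OF multigraded_submodule_monomial_ideal[OF assms]] by blast
  define X0 where "X0 = (1::nat, q0, \<gamma>0, A0)"
  have "minimal_step X0" using h0 m0 by (auto simp: X0_def minimal_step_def)
  then have "\<exists>X. \<forall>n. (minimal_step (X n) \<and> (n = 0 \<longrightarrow> X n = X0)) \<and> next_step (X n) (X (Suc n))"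
  proof (intro dependent_nat_choice)
    show "\<exists>X. minimal_step X \<and> (0 = 0 \<longrightarrow> X = X0)" using \<open>minimal_step X0\<close> by blast
  qed (use minimal_step_next in blast)
  then obtain X where X: "\<And>n. minimal_step (X n)" "X 0 = X0" "\<And>n. next_step (X n) (X (Suc n))" by blast
  define r where "r n = fst (X n)" for n
  define q where "q n = fst (snd (X n))" for n
  define \<gamma> where "\<gamma> n = fst (snd (snd (X n)))" for n
  define A where "A n = snd (snd (snd (X n)))" for n
  have Xn: "X n = (r n, q n, \<gamma> n, A n)" for n by (simp add: r_def q_def \<gamma>_def A_def)
  have r: "r 0 = 1" "r (Suc n) = q n" for n
    using X(3)[of n] by (simp_all add: r_def X(2) X0_def) (simp add: next_step_def Xn)
  have init: "q 0 = q0" "\<gamma> 0 = \<gamma>0" "A 0 = A0" by (simp_all add: q_def \<gamma>_def A_def X(2) X0_def)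
  have h: "mhomog (\<gamma> n) (\<gamma> (Suc n) c) (\<lambda>b. A (Suc n) b c)" if "c < q (Suc n)" for n c
    using X(3)[of n] that by (simp add: next_step_def Xn)
  have ex: "(\<forall>a<r n. (\<Sum>b<q n. A n a b * w b) = 0) \<longleftrightarrow>
      (\<exists>u. \<forall>b<q n. w b = (\<Sum>c<q (Suc n). A (Suc n) b c * u c))" for n w
    using X(3)[of n] by (simp add: next_step_def Xn)
  have min: "lookup (u c) 0 = 0" if "\<forall>b<r n. (\<Sum>c<q n. A n b c * u c) = 0" "c < q n" for u c n
    using X(1)[of n] that by (simp add: minimal_step_def Xn)
  \<comment> \<open>The matrix \<open>A 0\<close> has a single row and serves as the augmentation,
    so the differentials begin with \<open>A 1\<close>.\<close>
  define F where "F = \<lparr>rk = q, shift = (\<lambda>n b. int (mon_degree (\<gamma> n b))),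
    bd = (\<lambda>n. mat (q n) (q (Suc n)) (\<lambda>(a, b). A (Suc n) a b)), aug = A 0 0\<rparr>"
  have rk: "res_rank F n = r n" for n by (cases n) (simp_all add: res_rank_def F_def r)
  have ent: "res_entry F n a b = A n a b" if "a < r n" "b < q n" for n a b
    using that by (cases n) (simp_all add: res_entry_def F_def r)
  have sh: "res_shift F (Suc n) b = int (mon_degree (\<gamma> n b))" for n b by (simp add: res_shift_def F_def)
  have sh0: "res_shift F 0 a = 0" for a by (simp add: res_shift_def)
  have sum: "(\<Sum>b<q n. res_entry F n a b * w b) = (\<Sum>b<q n. A n a b * w b)" if "a < r n" for n a w
    using that by (simp add: ent)
  have "minimal_graded_free_resolution (*) homog J F"
    unfolding minimal_graded_free_resolution_iff rk r(2)
  proof (intro conjI allI impI)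
    show "bd F i \<in> carrier_mat (rk F i) (rk F (Suc i))" for i by (simp add: F_def)
  next
    fix i a b assume a: "a < r i" and b: "b < q i"
    show "res_entry F i a b \<in> homog (res_shift F (Suc i) b - res_shift F i a)"
    proof (cases i)
      case 0
      then show ?thesis using mhomogD[OF h0, of b] a b
        by (auto simp: ent sh init homog_def sh0)
    next
      case (Suc j)
      have "int (mon_degree m) = int (mon_degree (\<gamma> i b)) - int (mon_degree (\<gamma> j a))"
        if "m \<in> keys (A i a b)" for m
      proof -
        have "\<gamma> j a + m = \<gamma> i b" using mhomogD[OF h] b that Suc by blast
        then have "mon_degree (\<gamma> i b) = mon_degree (\<gamma> j a) + mon_degree m" by (metis mon_degree_add)
        then show ?thesis by simp
      qed
      then show ?thesis using a b by (simp add: ent sh homog_def Suc)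
    qed
  next
    fix p
    have "p \<in> J \<longleftrightarrow> (\<lambda>b::nat. if b = 0 then p else 0) \<in> ?N" by simp
    also have "\<dots> \<longleftrightarrow> (\<exists>u. p = (\<Sum>c<q0. A0 0 c * u c))"
    proof
      assume "(\<lambda>b::nat. if b = 0 then p else 0) \<in> ?N"
      then obtain u where "\<And>b::nat. (if b = 0 then p else 0) = (\<Sum>c<q0. A0 b c * u c)"
        unfolding g0 by blast
      from this[of 0] show "\<exists>u. p = (\<Sum>c<q0. A0 0 c * u c)" by auto
    next
      assume "\<exists>u. p = (\<Sum>c<q0. A0 0 c * u c)"
      then obtain u where u: "p = (\<Sum>c<q0. A0 0 c * u c)" by blast
      have "(\<lambda>b. \<Sum>c<q0. A0 b c * u c) \<in> ?N" unfolding g0 by blast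
      then show "(\<lambda>b::nat. if b = 0 then p else 0) \<in> ?N" by (simp add: u)
    qed
    finally show "p \<in> J \<longleftrightarrow> (\<exists>u. p = (\<Sum>b<r 1. res_entry F 0 0 b * u b))"
      using sum[of 0 0] r(2)[of 0] by (simp add: r(1) init)
  next
    fix i w
    show "(\<forall>a<r i. (\<Sum>b<q i. res_entry F i a b * w b) = 0) \<longleftrightarrow>
        (\<exists>u. \<forall>b<q i. w b = (\<Sum>c<q (Suc i). res_entry F (Suc i) b c * u c))"
      using ex[of i w] by (simp add: sum r(2))
  next
    fix i a b assume a: "a < q i" and b: "b < q (Suc i)"
    \<comment> \<open>The unit vector shows that a column of \<open>A (Suc i)\<close> lies in its
      image, hence is a relation among the columns of \<open>A i\<close>; minimality says that such
      a relation has no constant terms.\<close>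
    let ?u = "\<lambda>c. if c = b then 1 else 0"
    have "(\<Sum>c<q (Suc i). A (Suc i) a' c * ?u c) = A (Suc i) a' b" for a'
      using b by (subst sum.mono_neutral_right[of _ "{b}"]) auto
    then have "\<exists>u. \<forall>a'<q i. A (Suc i) a' b = (\<Sum>c<q (Suc i). A (Suc i) a' c * u c)"
      by (intro exI[of _ ?u]) simp
    then have "\<forall>a'<r i. (\<Sum>b'<q i. A i a' b' * A (Suc i) b' b) = 0"
      using ex[of i "\<lambda>a. A (Suc i) a b"] by (rule iffD2[rotated])
    then have "lookup (A (Suc i) a b) 0 = 0" using a by (rule min)
    then show "res_entry F (Suc i) a b \<in> irrelevant_ideal"
      using a b by (simp add: ent r(2) irrelevant_idealI)
  qed
  then show ?thesis by blast
qed

section \<open>The Koszul class of an induced matching\<close>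

lemma lookup_ksign_mult: "lookup (ksign \<rho> v S * p) m = ksign \<rho> v S * lookup p m"
  for p :: "('v::finite, 'k::comm_ring_1) mpoly"
proof -
  have "lookup ((- 1) ^ n * p) m = (- 1) ^ n * lookup p m" for n
    by (induction n) simp_all
  then show ?thesis by (simp add: ksign_def)
qed

text \<open>An additive weight with values in the naturals cannot decrease under multiplication, so
  a lower bound on generators passes to the ideal.\<close>

lemma ideal_gen_keys_weight:
  fixes wt :: "('v::finite \<Rightarrow>\<^sub>0 nat) \<Rightarrow> nat" and S :: "('v, 'k::comm_ring_1) mpoly set"
  assumes "\<And>m n. wt (m + n) = wt m + wt n"
    and "\<And>p m. p \<in> S \<Longrightarrow> m \<in> keys p \<Longrightarrow> k \<le> wt m"
    and "p \<in> ideal_gen S" "m \<in> keys p"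
  shows "k \<le> wt m"
  using assms(3,4) unfolding ideal_gen_def
proof (induction p arbitrary: m rule: idl.span_induct_alt)
  case (step c x y)
  then consider "m \<in> keys (c * x)" | "m \<in> keys y" using keys_add[of "c * x" y] by blast
  then show ?case
  proof cases
    case 1
    then obtain i j where "m = i + j" "j \<in> keys x" using keys_mult[of c x] by blast
    then show ?thesis using assms(1,2) step(1) by (simp add: trans_le_add2)
  qed (use step in blast)
qed simp

text \<open>Every edge meets the cover \<open>C\<close>, so each of the \<open>s\<close> factors
  contributes at least 1 to the degree in the variables of \<open>C\<close>.\<close>

lemma edge_ideal_power_cover_weight:
  fixes p :: "('v::finite, 'k::comm_ring_1) mpoly"
  assumes cover: "\<And>e. e \<in> E \<Longrightarrow> e \<inter> C \<noteq> {}"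
    and "p \<in> ideal_power (edge_ideal E) s" "m \<in> keys p"
  shows "s \<le> (\<Sum>v\<in>C. lookup m v)"
  using assms(2,3)
proof (induction s arbitrary: p m)
  case (Suc s)
  let ?wt = "\<lambda>m. \<Sum>v\<in>C. lookup m v"
  have add: "?wt (m + n) = ?wt m + ?wt n" for m n by (simp add: lookup_add sum.distrib)
  have edge: "1 \<le> ?wt m" if "a \<in> edge_ideal E" "m \<in> keys a" for a :: "('v, 'k) mpoly" and m
    using add _ that unfolding edge_ideal_def
  proof (rule ideal_gen_keys_weight)
    fix q :: "('v, 'k) mpoly" and m assume "q \<in> {var u * var v |u v. {u, v} \<in> E}" "m \<in> keys q"
    then obtain u v where "{u, v} \<in> E" "m = single u 1 + single v 1"
      by (auto simp: var_def mult_single split: if_splits)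
    then obtain x where "x \<in> C" "lookup m x \<noteq> 0" using cover[of "{u, v}"] by (auto simp: lookup_add)
    then have "1 \<le> lookup m x" by simp
    also have "\<dots> \<le> ?wt m" using \<open>x \<in> C\<close> by (intro member_le_sum) auto
    finally show "1 \<le> ?wt m" .
  qed
  show ?case
    using add _ Suc.prems unfolding ideal_power.simps
  proof (rule ideal_gen_keys_weight)
    fix q :: "('v, 'k) mpoly" and m
    assume "q \<in> {a * b |a b. a \<in> edge_ideal E \<and> b \<in> ideal_power (edge_ideal E) s}" "m \<in> keys q"
    then obtain a b where ab: "q = a * b" "a \<in> edge_ideal E" "b \<in> ideal_power (edge_ideal E) s" by blast
    with \<open>m \<in> keys q\<close> obtain i j where "m = i + j" "i \<in> keys a" "j \<in> keys b"
      using keys_mult[of a b] by blast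
    moreover have "1 \<le> ?wt i" "s \<le> ?wt j" using calculation edge[of a] Suc.IH[of b] ab by blast+
    ultimately show "Suc s \<le> ?wt m" using add[of i j] by simp
  qed
qed simp

lemma ideal_power_mult_left:
  "0 < s \<Longrightarrow> p \<in> ideal_power I s \<Longrightarrow> q * p \<in> ideal_power I s"
  by (cases s) (simp_all add: ideal_gen_def idl.span_scale)

lemma power_mult_in_ideal_power:
  assumes "f \<in> I" "p \<in> I"
  shows "f ^ s * p \<in> ideal_power I (Suc s)"
proof (induction s)
  case 0
  have "p * 1 \<in> {a * b |a b. a \<in> I \<and> b \<in> ideal_power I 0}"
    using assms(2) unfolding ideal_power.simps by blast
  then have "p * 1 \<in> ideal_power I (Suc 0)"
    unfolding ideal_power.simps(2)[of I 0] ideal_gen_def by (rule idl.span_base)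
  then show ?case by simp
next
  case (Suc s)
  have "f * (f ^ s * p) \<in> {a * b |a b. a \<in> I \<and> b \<in> ideal_power I (Suc s)}" using assms(1) Suc by blast
  then have "f * (f ^ s * p) \<in> ideal_power I (Suc (Suc s))"
    unfolding ideal_power.simps(2)[of I "Suc s"] ideal_gen_def by (rule idl.span_base)
  then show ?case by (simp add: mult.assoc)
qed

section \<open>Squarefree monomials and powers of variables\<close>

definition indicator_mon :: "'v::finite set \<Rightarrow> 'v \<Rightarrow>\<^sub>0 nat" where
  "indicator_mon X = (\<Sum>v\<in>X. single v 1)"

lemma lookup_indicator_mon: "lookup (indicator_mon X) v = (if v \<in> X then 1 else 0)"
proof -
  have "lookup (indicator_mon X) v = (\<Sum>u\<in>X. if u = v then 1 else 0)"
    by (simp add: indicator_mon_def lookup_sum lookup_single when_def)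
  then show ?thesis by simp
qed

lemma mon_degree_indicator_mon: "mon_degree (indicator_mon X) = card X"
  by (simp add: mon_degree_def lookup_indicator_mon flip: sum.inter_filter)

lemma prod_var_eq_single: "(\<Prod>v\<in>X. var v) = single (indicator_mon X) (1::'k::comm_ring_1)"
  for X :: "'v::finite set"
proof -
  have "finite X" by simp
  then show ?thesis
    by (induction X rule: finite_induct) (simp_all add: indicator_mon_def var_def mult_single)
qed

lemma var_power_eq_single: "var u ^ k = single (single u k) (1::'k::comm_ring_1)"
proof (induction k)
  case (Suc k)
  have "single u (1::nat) + single u k = single u (Suc k)" by (simp add: single_add[symmetric])
  with Suc show ?case by (simp add: var_def mult_single)
qed simp

lemma pair_order_exists:
  fixes a b :: "'e \<Rightarrow> 'v::finite"
  assumes "finite M" "\<And>e. e \<in> M \<Longrightarrow> a e \<noteq> b e"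
    and "\<And>e e'. e \<in> M \<Longrightarrow> e' \<in> M \<Longrightarrow> e \<noteq> e' \<Longrightarrow> {a e, b e} \<inter> {a e', b e'} = {}"
  shows "\<exists>\<rho> :: 'v \<Rightarrow> nat. inj \<rho> \<and> (\<forall>e\<in>M. \<rho> (b e) = Suc (\<rho> (a e)))"
proof -
  obtain h :: "'e \<Rightarrow> nat" where h: "inj_on h M" "h ` M = {..<card M}"
    using ex_bij_betw_finite_nat[OF assms(1)] by (auto simp: bij_betw_def lessThan_atLeast0)
  obtain r :: "'v \<Rightarrow> nat" where r: "inj r"
    using finite_imp_inj_to_nat_seg[of "UNIV :: 'v set"] by auto
  define ed where "ed v = (THE e. e \<in> M \<and> v \<in> {a e, b e})" for v
  have ed: "ed v = e" if "e \<in> M" "v \<in> {a e, b e}" for e v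
    unfolding ed_def using that assms(3) by (intro the_equality) blast+
  define U where "U = (\<Union>e\<in>M. {a e, b e})"
  \<comment> \<open>The pair number \<open>h\<close> occupies the places \<open>2 * h\<close> and
    \<open>2 * h + 1\<close>; all other vertices follow from \<open>2 * card M\<close> on.\<close>
  define \<rho> where "\<rho> v = (if v \<in> U then 2 * h (ed v) + (if v = b (ed v) then 1 else 0) else 2 * card M + r v)" for v
  have U: "ed v \<in> M" "v = a (ed v) \<or> v = b (ed v)" if "v \<in> U" for v
    using that ed by (auto simp: U_def)
  have less: "\<rho> v < 2 * card M" if "v \<in> U" for v
  proof -
    have "h (ed v) < card M" using h(2) U(1)[OF that] by blast
    then show ?thesis using that by (simp add: \<rho>_def)
  qed
  have ge: "2 * card M \<le> \<rho> v" if "v \<notin> U" for v using that by (simp add: \<rho>_def)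
  have "inj \<rho>"
  proof (rule injI)
    fix u v assume eq: "\<rho> u = \<rho> v"
    show "u = v"
    proof (cases "u \<in> U")
      case True
      then have v: "v \<in> U" using eq less[of u] ge[of v] by (metis not_le)
      have "\<rho> u div 2 = h (ed u)" "\<rho> v div 2 = h (ed v)" using True v by (simp_all add: \<rho>_def)
      then have e: "ed u = ed v" using eq U(1)[OF True] U(1)[OF v] h(1) by (metis inj_onD)
      then have "u = b (ed u) \<longleftrightarrow> v = b (ed v)" using eq True v by (auto simp: \<rho>_def split: if_splits)
      then show ?thesis using e U(2)[OF True] U(2)[OF v] by metis
    next
      case False
      then have v: "v \<notin> U" using eq less[of v] ge[of u] by (metis not_le)
      then show ?thesis using eq False r by (simp add: \<rho>_def inj_eq)
    qed
  qed
  moreover have "\<rho> (b e) = Suc (\<rho> (a e))" if "e \<in> M" for e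
  proof -
    have "ed (a e) = e" "ed (b e) = e" "a e \<in> U" "b e \<in> U" using that ed by (auto simp: U_def)
    then show ?thesis using assms(2)[OF that] by (simp add: \<rho>_def)
  qed
  ultimately show ?thesis by blast
qed

text \<open>The functional that detects the Koszul class of an induced matching \<open>{a e, b e}\<close>: it adds up
  the coefficients of \<open>x\<^sup>\<mu> x\<^sub>U\<^sub>-\<^sub>T e\<^sub>T\<close> over the transversals \<open>T\<close>. Boundaries are killed because
  exchanging \<open>a e\<close> and \<open>b e\<close>, which are adjacent in the order \<open>\<rho>\<close>, changes the sign.\<close>

locale vertex_pairs =
  fixes M :: "'e set" and a b :: "'e \<Rightarrow> 'v::finite" and \<rho> :: "'v \<Rightarrow> nat"
  assumes finite_M: "finite M" and neq: "e \<in> M \<Longrightarrow> a e \<noteq> b e"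
    and disj: "e \<in> M \<Longrightarrow> e' \<in> M \<Longrightarrow> e \<noteq> e' \<Longrightarrow> {a e, b e} \<inter> {a e', b e'} = {}"
    and inj: "inj \<rho>" and adjacent: "e \<in> M \<Longrightarrow> \<rho> (b e) = Suc (\<rho> (a e))"
begin

definition U :: "'v set" where "U = (\<Union>e\<in>M. {a e, b e})"

definition transversals :: "'v set set" where
  "transversals = {T. T \<subseteq> U \<and> (\<forall>e\<in>M. a e \<in> T \<longleftrightarrow> b e \<notin> T)}"

definition detect ::
  "('v \<Rightarrow>\<^sub>0 nat) \<Rightarrow> ('v set \<Rightarrow> ('v, 'k::comm_ring_1) mpoly) \<Rightarrow> 'k" where
  "detect \<mu> c = (\<Sum>T\<in>transversals. lookup (c T) (\<mu> + indicator_mon (U - T)))"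

text \<open>No vertex lies between \<open>a e\<close> and \<open>b e\<close>, so both see the same
  part of \<open>R\<close>; the sign comes from \<open>a e\<close> preceding
  \<open>b e\<close>.\<close>

lemma ksign_exchange:
  assumes "e \<in> M" "a e \<notin> R" "b e \<notin> R"
  shows "ksign \<rho> (a e) (insert (b e) R) = - ksign \<rho> (b e) (insert (a e) R)"
proof -
  have "\<rho> u < \<rho> (a e) \<longleftrightarrow> \<rho> u < \<rho> (b e)" if "u \<in> R" for u
    using adjacent[OF assms(1)] that assms(2) inj by (metis inj_eq less_Suc_eq)
  then have "{u \<in> R. \<rho> u < \<rho> (a e)} = {u \<in> R. \<rho> u < \<rho> (b e)}" by auto
  then have "ksign \<rho> (a e) R = ksign \<rho> (b e) R" by (simp add: ksign_def)
  then show ?thesis using assms adjacent[OF assms(1)] by (simp add: ksign_insert)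
qed

lemma detect_koszul:
  assumes \<mu>: "\<And>v. v \<notin> U \<Longrightarrow> lookup \<mu> v = 0"
  shows "detect \<mu> (koszul \<rho> t) = (0 :: 'k::comm_ring_1)"
proof -
  define F :: "'v set \<Rightarrow> 'v \<Rightarrow> 'k" where
    "F T v = ksign \<rho> v T * lookup (t (insert v T)) (\<mu> + indicator_mon (U - insert v T))" for T v
  define miss where "miss T e = (if a e \<in> T then b e else a e)" for T e
  \<comment> \<open>Dividing by a vertex \<open>v\<close> of \<open>U\<close> turns the exponent for
    \<open>T\<close> into the one for \<open>insert v T\<close>. If \<open>v\<close> is outside
    \<open>U\<close>, the exponent is not divisible by \<open>v\<close> and the term
    vanishes.\<close>
  have trm: "lookup (ksign \<rho> v T * (var v * t (insert v T))) (\<mu> + indicator_mon (U - T)) =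
      (if v \<in> U then F T v else 0)" if "v \<notin> T" for v T
  proof (cases "v \<in> U")
    case True
    then have "\<mu> + indicator_mon (U - T) - single v 1 = \<mu> + indicator_mon (U - insert v T)"
      using that
      by (intro poly_mapping_eqI) (auto simp: lookup_add lookup_minus lookup_indicator_mon lookup_single when_def)
    then show ?thesis using True that
      by (simp add: lookup_ksign_mult lookup_var_mult F_def lookup_add lookup_indicator_mon)
  next
    case False
    then show ?thesis
      using \<mu> by (simp add: lookup_ksign_mult lookup_var_mult lookup_add lookup_indicator_mon)
  qed
  have "detect \<mu> (koszul \<rho> t) =
      (\<Sum>T\<in>transversals. \<Sum>v\<in>-T. lookup (ksign \<rho> v T * (var v * t (insert v T))) (\<mu> + indicator_mon (U - T)))"
    by (simp add: detect_def koszul_def lookup_sum)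
  also have "\<dots> = (\<Sum>T\<in>transversals. \<Sum>v\<in>-T. if v \<in> U then F T v else 0)"
    by (intro sum.cong refl trm) simp
  also have "\<dots> = (\<Sum>T\<in>transversals. \<Sum>e\<in>M. F T (miss T e))"
  proof (intro sum.cong refl)
    fix T assume T: "T \<in> transversals"
    have iff: "a e \<in> T \<longleftrightarrow> b e \<notin> T" if "e \<in> M" for e using T that by (simp add: transversals_def)
    \<comment> \<open>The vertices of \<open>U\<close> not in \<open>T\<close> are the partners of
      its members, one for each pair, so the sum over vertices becomes a sum over
      \<open>M\<close>.\<close>
    have im: "U - T = miss T ` M"
    proof (intro equalityI subsetI)
      fix v assume "v \<in> U - T"
      then obtain e where "e \<in> M" "v = a e \<or> v = b e" "v \<notin> T" unfolding U_def by blast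
      then show "v \<in> miss T ` M" using iff by (intro image_eqI[of _ _ e]) (auto simp: miss_def)
    next
      fix v assume "v \<in> miss T ` M"
      then obtain e where "e \<in> M" "v = miss T e" by blast
      then show "v \<in> U - T" using iff by (auto simp: miss_def U_def)
    qed
    have "inj_on (miss T) M"
    proof (rule inj_onI, rule ccontr)
      fix e e' assume e: "e \<in> M" "e' \<in> M" "miss T e = miss T e'" "e \<noteq> e'"
      have "miss T x \<in> {a x, b x}" for x by (simp add: miss_def)
      then have "miss T e \<in> {a e, b e} \<inter> {a e', b e'}" using e(3) by (metis IntI)
      with disj[OF e(1,2,4)] show False by blast
    qed
    then have "(\<Sum>e\<in>M. F T (miss T e)) = (\<Sum>v\<in>U - T. F T v)" by (simp add: im sum.reindex)
    also have "\<dots> = (\<Sum>v\<in>-T. if v \<in> U then F T v else 0)"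
      by (intro sum.mono_neutral_cong_left) auto
    finally show "(\<Sum>v\<in>-T. if v \<in> U then F T v else 0) = (\<Sum>e\<in>M. F T (miss T e))" ..
  qed
  also have "\<dots> = (\<Sum>e\<in>M. \<Sum>T\<in>transversals. F T (miss T e))" by (rule sum.swap)
  also have "\<dots> = 0"
  proof (rule sum.neutral, rule ballI)
    fix e assume e: "e \<in> M"
    let ?A = "{T \<in> transversals. a e \<in> T}" and ?B = "{T \<in> transversals. a e \<notin> T}"
    \<comment> \<open>For a fixed pair, exchanging its endpoints matches the transversals through
      \<open>a e\<close> with those through \<open>b e\<close>.\<close>
    have exch: "insert x (T - {y}) \<in> transversals \<and> y \<notin> insert x (T - {y})"
      if "T \<in> transversals" "{x, y} = {a e, b e}" "x \<noteq> y" for T x y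
    proof (intro conjI)
      have "insert x (T - {y}) \<subseteq> U" using that e by (auto simp: transversals_def U_def doubleton_eq_iff)
      moreover have "a e' \<in> insert x (T - {y}) \<longleftrightarrow> b e' \<notin> insert x (T - {y})" if e': "e' \<in> M" for e'
      proof (cases "e' = e")
        case True
        then show ?thesis using \<open>{x, y} = {a e, b e}\<close> \<open>x \<noteq> y\<close> by (auto simp: doubleton_eq_iff)
      next
        case False
        then have "a e' \<notin> {x, y}" "b e' \<notin> {x, y}" unfolding \<open>{x, y} = {a e, b e}\<close>
          using disj[OF e' e] by blast+
        moreover have "a e' \<in> T \<longleftrightarrow> b e' \<notin> T" using \<open>T \<in> transversals\<close> e' by (simp add: transversals_def)
        ultimately show ?thesis by blast
      qed
      ultimately show "insert x (T - {y}) \<in> transversals" by (simp add: transversals_def)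
    qed (use \<open>x \<noteq> y\<close> in blast)
    have swapA: "insert (b e) (T - {a e}) \<in> ?B" if "T \<in> ?A" for T
      using exch[OF _ insert_commute, of T] that neq[OF e] by fastforce
    have swapB: "insert (a e) (T - {b e}) \<in> ?A" if "T \<in> ?B" for T
      using exch[of T "a e" "b e"] that neq[OF e] by blast
    have "transversals = ?A \<union> ?B" by auto
    then have "(\<Sum>T\<in>transversals. F T (miss T e)) = (\<Sum>T\<in>?A \<union> ?B. F T (miss T e))" by simp
    also have "\<dots> = (\<Sum>T\<in>?A. F T (b e)) + (\<Sum>T\<in>?B. F T (a e))"
      by (subst sum.union_disjoint) (auto simp: miss_def)
    also have "(\<Sum>T\<in>?B. F T (a e)) = (\<Sum>T\<in>?A. - F T (b e))"
    proof (rule sum.reindex_bij_witness[of _ "\<lambda>T. insert (b e) (T - {a e})" "\<lambda>T. insert (a e) (T - {b e})"])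
      fix T assume T: "T \<in> ?B"
      then have bT: "b e \<in> T" "a e \<notin> T" using e by (auto simp: transversals_def)
      then show "insert (b e) (insert (a e) (T - {b e}) - {a e}) = T" by auto
      show "insert (a e) (T - {b e}) \<in> ?A" by (rule swapB[OF T])
      \<comment> \<open>Adding the missing endpoint to either of the two matched transversals gives
        the same set, so the two terms share their coefficient and differ only in sign.\<close>
      have "insert (b e) (insert (a e) (T - {b e})) = insert (a e) T" using bT by auto
      moreover have "ksign \<rho> (a e) T = (- ksign \<rho> (b e) (insert (a e) (T - {b e})) :: 'k)"
        using ksign_exchange[OF e, of "T - {b e}"] bT by (simp add: insert_absorb)
      ultimately show "- F (insert (a e) (T - {b e})) (b e) = F T (a e)"
        by (simp add: F_def)
    next
      fix T assume T: "T \<in> ?A"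
      then have "a e \<in> T" "b e \<notin> T" using e by (auto simp: transversals_def)
      then show "insert (a e) (insert (b e) (T - {a e}) - {b e}) = T" by auto
      show "insert (b e) (T - {a e}) \<in> ?B" by (rule swapA[OF T])
    qed
    also have "(\<Sum>T\<in>?A. F T (b e)) + \<dots> = 0" by (simp add: sum_negf)
    finally show "(\<Sum>T\<in>transversals. F T (miss T e)) = 0" .
  qed
  finally show ?thesis .
qed

end

text \<open>If a chain \<open>u\<close> over \<open>J\<close> had the same boundary as
  \<open>c\<close>, then \<open>c - u\<close> would be a cycle over the ring and so a boundary, on
  which \<open>detect\<close> vanishes. But \<open>detect\<close> is 0 on \<open>u\<close> and 1 on
  \<open>c\<close>.\<close>

lemma (in vertex_pairs) koszul_class_not_boundary:
  fixes J :: "('v, 'k::field) mpoly set"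
  assumes nz: "M \<noteq> {}" and \<mu>: "\<And>v. v \<notin> U \<Longrightarrow> lookup \<mu> v = 0"
    and J: "\<And>p T. p \<in> J \<Longrightarrow> T \<in> transversals \<Longrightarrow> lookup p (\<mu> + indicator_mon (U - T)) = 0"
    and u: "\<And>S. u S \<in> J" "\<And>S. card S \<noteq> card M \<Longrightarrow> u S = 0"
  defines "c \<equiv> \<lambda>S. if S = b ` M then single (\<mu> + indicator_mon (a ` M)) 1 else 0"
  assumes eq: "\<And>S. koszul \<rho> c S = koszul \<rho> u S"
  shows False
proof -
  have inj_b: "inj_on b M" using disj by (intro inj_onI) blast
  have ab: "a e \<noteq> b e'" if "e \<in> M" "e' \<in> M" for e e'
    using that disj[OF that] neq by blast
  have B: "b ` M \<in> transversals" using ab by (auto simp: transversals_def U_def)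
  have UB: "U - b ` M = a ` M" using ab by (auto simp: U_def)
  \<comment> \<open>Exactness is available only in positive homological degree, which is where the
    matching has to be non-empty.\<close>
  obtain p where p: "card M = Suc p" using nz finite_M by (metis card_eq_0_iff old.nat.exhaust)
  have "\<exists>t. (\<forall>S. card S \<noteq> Suc (Suc p) \<longrightarrow> t S = 0) \<and> (\<forall>S. c S - u S = koszul \<rho> t S)"
    using eq u(2) p card_image[OF inj_b]
    by (intro koszul_exact[OF inj]) (auto simp: koszul_diff c_def)
  then obtain t where "\<And>S. c S - u S = koszul \<rho> t S" by blast
  then have "detect \<mu> (\<lambda>S. c S - u S) = detect \<mu> (koszul \<rho> t)" by presburger
  also have "\<dots> = 0" using \<mu> by (rule detect_koszul)
  finally have "(\<Sum>T\<in>transversals. lookup (c T) (\<mu> + indicator_mon (U - T))) =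
      (\<Sum>T\<in>transversals. lookup (u T) (\<mu> + indicator_mon (U - T)))"
    by (simp add: detect_def lookup_minus sum_subtractf)
  also have "\<dots> = 0" using J u(1) by (intro sum.neutral) blast
  also have "(\<Sum>T\<in>transversals. lookup (c T) (\<mu> + indicator_mon (U - T))) =
      (\<Sum>T\<in>{b ` M}. lookup (c T) (\<mu> + indicator_mon (U - T)))"
    using B by (intro sum.mono_neutral_right) (auto simp: c_def)
  also have "\<dots> = 1" by (simp add: c_def UB)
  finally show False by simp
qed

text \<open>The degree minus the homological degree \<open>card M - 1\<close> of this generator is
  \<open>2 * s + card M - 1\<close>, the bound to be proved.\<close>

lemma induced_matching_shift:
  fixes E :: "'v::finite set set"
  assumes E: "simple_graph E" and M: "induced_matching E M" "M \<noteq> {}" and s: "0 < s"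
    and F: "minimal_graded_free_resolution (*) homog
      (ideal_power (edge_ideal E :: ('v, 'k::field) mpoly set) s) F"
  shows "\<exists>c<rk F (card M - 1). shift F (card M - 1) c = 2 * int s + 2 * int (card M) - 2"
proof (rule ccontr)
  assume neg: "\<not> ?thesis"
  let ?I = "edge_ideal E :: ('v, 'k) mpoly set"
  let ?J = "ideal_power ?I s"
  obtain p where p: "card M = Suc p" using M(2) by (metis card_eq_0_iff finite old.nat.exhaust)
  obtain s' where s': "s = Suc s'" using s gr0_implies_Suc by blast
  have ME: "M \<subseteq> E" and pd: "pairwise disjnt M" and ind: "\<And>e. e \<in> E \<Longrightarrow> e \<subseteq> \<Union>M \<Longrightarrow> e \<in> M"
    using M(1) by (auto simp: induced_matching_def)
  have "\<forall>e\<in>M. \<exists>x y. e = {x, y} \<and> x \<noteq> y"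
    using E ME by (auto simp: simple_graph_def card_2_iff)
  then obtain a b where ab: "\<And>e. e \<in> M \<Longrightarrow> e = {a e, b e}" "\<And>e. e \<in> M \<Longrightarrow> a e \<noteq> b e" by metis
  have dj: "{a e, b e} \<inter> {a e', b e'} = {}" if "e \<in> M" "e' \<in> M" "e \<noteq> e'" for e e'
    using pd that ab(1)[OF that(1)] ab(1)[OF that(2)] by (auto simp: pairwise_def disjnt_def)
  obtain \<rho> :: "'v \<Rightarrow> nat" where \<rho>: "inj \<rho>" "\<And>e. e \<in> M \<Longrightarrow> \<rho> (b e) = Suc (\<rho> (a e))"
    using pair_order_exists[of M a b] ab(2) dj by auto
  interpret vertex_pairs M a b \<rho>
    by unfold_locales (use ab(2) dj \<rho> in auto)
  have UM: "U = \<Union>M" unfolding U_def using ab(1) by auto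
  obtain e0 where e0: "e0 \<in> M" using M(2) by blast
  \<comment> \<open>The exponent of the power \<open>s - 1\<close> of one fixed edge of the
    matching.\<close>
  define \<mu> where "\<mu> = single (a e0) s' + single (b e0) s'"
  define W :: "('v, 'k) mpoly" where "W = single (\<mu> + indicator_mon (a ` M)) 1"
  have inj_a: "inj_on a M" using dj by (intro inj_onI) blast
  have inj_b: "inj_on b M" using dj by (intro inj_onI) blast
  have W: "W = (var (a e0) * var (b e0)) ^ s' * (\<Prod>e\<in>M. var (a e))"
  proof -
    have "(\<Prod>e\<in>M. var (a e) :: ('v, 'k) mpoly) = (\<Prod>v\<in>a ` M. var v)" by (simp add: prod.reindex[OF inj_a])
    then show ?thesis
      by (simp add: W_def \<mu>_def power_mult_distrib var_power_eq_single prod_var_eq_single mult_single)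
  qed
  have edge: "var (a e) * var (b e) \<in> ?I" if "e \<in> M" for e
  proof -
    have "{a e, b e} \<in> E" using ab(1)[OF that] that ME by auto
    then show ?thesis unfolding edge_ideal_def ideal_gen_def by (intro idl.span_base) blast
  qed
  have WJ: "var (b e) * W \<in> ?J" if "e \<in> M" for e
  proof -
    have "(\<Prod>e\<in>M. var (a e) :: ('v, 'k) mpoly) = var (a e) * (\<Prod>e\<in>M - {e}. var (a e))"
      using that by (simp add: prod.remove)
    \<comment> \<open>The factor \<open>var (b e)\<close> completes \<open>var (a e)\<close> to an
      edge, which together with the \<open>s'\<close> copies of \<open>e0\<close> gives
      \<open>s\<close> edges.\<close>
    then have "var (b e) * W =
        (\<Prod>e\<in>M - {e}. var (a e)) * ((var (a e0) * var (b e0)) ^ s' * (var (a e) * var (b e)))"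
      unfolding W by (simp add: algebra_simps)
    then show ?thesis
      using power_mult_in_ideal_power[OF edge[OF e0] edge[OF that], of s'] ideal_power_mult_left[OF s] s' by simp
  qed
  have J: "idl.subspace ?J" using monomial_ideal_power[OF monomial_ideal_edge_ideal]
    unfolding monomial_ideal_def by blast
  define c where "c S = (if S = b ` M then W else 0)" for S
  have zJ: "koszul \<rho> c S \<in> ?J" for S
    unfolding koszul_def
  proof (rule idl.subspace_sum[OF J], rule idl.subspace_scale[OF J])
    fix v assume "v \<in> - S"
    show "var v * c (insert v S) \<in> ?J"
    proof (cases "insert v S = b ` M")
      case True
      then obtain e where "e \<in> M" "v = b e" by blast
      then show ?thesis using WJ True by (simp add: c_def)
    next
      case False
      then show ?thesis using idl.subspace_0[OF J] by (simp add: c_def)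
    qed
  qed
  let ?d = "2 * int s + 2 * int (card M) - 2"
  \<comment> \<open>The internal degree \<open>?d\<close> of the cycle counts the degree of the
    coefficients of its boundary plus its homological degree \<open>p\<close>; the coefficient
    \<open>W\<close> therefore has degree \<open>?d - p - 1\<close>.\<close>
  have "mon_degree (\<mu> + indicator_mon (a ` M)) = 2 * s' + card M"
    by (simp add: \<mu>_def mon_degree_add mon_degree_single mon_degree_indicator_mon card_image[OF inj_a])
  then have chom: "c S \<in> homog (?d - int p - 1)" for S
    using p s' by (simp add: c_def W_def homog_def)
  note F' = F[unfolded minimal_graded_free_resolution_iff]
  have hom: "res_entry F i x y \<in> homog (res_shift F (Suc i) y - res_shift F i x)"
    if "x < res_rank F i" "y < res_rank F (Suc i)" for i x y
    using F' that by blast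
  have memJ: "q \<in> ?J \<longleftrightarrow> (\<exists>u. q = (\<Sum>b<res_rank F 1. res_entry F 0 0 b * u b))" for q
    using F' by blast
  have exact: "(\<forall>a<res_rank F i. (\<Sum>b<res_rank F (Suc i). res_entry F i a b * w b) = 0) \<longleftrightarrow>
       (\<exists>u. \<forall>b<res_rank F (Suc i). w b = (\<Sum>c<res_rank F (Suc (Suc i)). res_entry F (Suc i) b c * u c))" for i w
    using F' by blast
  have r0: "res_rank F 0 = 1" by (simp add: res_rank_def)
  \<comment> \<open>Dimension shifting from position 0, where \<open>J\<close> is the image of the
    augmentation. Position \<open>Suc p\<close> is homological degree \<open>p\<close> of
    \<open>F\<close>, in which \<open>neg\<close> excludes generators of degree
    \<open>?d\<close>.\<close>
  have "\<exists>u. (\<forall>S. \<exists>w. \<forall>b<res_rank F 0. u b S = (\<Sum>c<res_rank F (Suc 0). res_entry F 0 b c * w c)) \<and>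
    (\<forall>b<res_rank F 0. \<forall>S. card S \<noteq> Suc p \<longrightarrow> u b S = 0) \<and>
    (\<forall>b<res_rank F 0. \<forall>S. koszul \<rho> c S = koszul \<rho> (u b) S)"
  proof (rule koszul_syzygy_boundary[where n = "res_rank F" and \<sigma> = "res_shift F"
        and A = "res_entry F" and i = 0 and z = "\<lambda>_. koszul \<rho> c" and p = p and d = ?d, OF \<rho>(1) hom exact])
    show "res_shift F (Suc (0 + p)) x \<noteq> ?d" if "x < res_rank F (Suc (0 + p))" for x
      using neg that p by (auto simp: res_rank_def res_shift_def)
    show "\<exists>w. \<forall>b<res_rank F 0. koszul \<rho> c S = (\<Sum>x<res_rank F (Suc 0). res_entry F 0 b x * w x)" for S
      using zJ[of S] unfolding memJ by (simp add: r0)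
    show "koszul \<rho> c S = 0" if "card S \<noteq> p" for S
    proof (rule koszul_support[OF _ that])
      show "c S = 0" if "card S \<noteq> Suc p" for S
        using that card_image[OF inj_b] p by (auto simp: c_def)
    qed
    show "koszul \<rho> c S \<in> homog (?d - int p - res_shift F 0 x)" for x S
    proof -
      have "koszul \<rho> c S \<in> homog (?d - int p - 1 + 1)" by (rule koszul_homog) (rule chom)
      also have "?d - int p - 1 + 1 = ?d - int p - res_shift F 0 x" by (simp add: res_shift_def)
      finally show ?thesis .
    qed
    show "koszul \<rho> (koszul \<rho> c) S = 0" for S by (rule koszul_koszul[OF \<rho>(1)])
  qed
  then obtain u
    where im: "\<forall>S. \<exists>w. \<forall>b<res_rank F 0. u b S = (\<Sum>c<res_rank F (Suc 0). res_entry F 0 b c * w c)"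
      and supp: "\<forall>b<res_rank F 0. \<forall>S. card S \<noteq> Suc p \<longrightarrow> u b S = 0"
      and bd: "\<forall>b<res_rank F 0. \<forall>S. koszul \<rho> c S = koszul \<rho> (u b) S"
    by (elim exE conjE)
  have u: "\<exists>w. u 0 S = (\<Sum>c<res_rank F (Suc 0). res_entry F 0 0 c * w c)"
    "card S \<noteq> Suc p \<Longrightarrow> u 0 S = 0" "koszul \<rho> c S = koszul \<rho> (u 0) S" for S
    using im supp bd by (simp_all add: r0)
  show False
  proof (rule koszul_class_not_boundary[OF M(2), where J = ?J and \<mu> = \<mu> and u = "u 0"])
    show "lookup \<mu> v = 0" if "v \<notin> U" for v
      using that e0 by (auto simp: \<mu>_def U_def lookup_add lookup_single when_def)
    show "u 0 S \<in> ?J" for S using u(1) memJ by simp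
    show "u 0 S = 0" if "card S \<noteq> card M" for S using that u(2) p by simp
    show "koszul \<rho> (\<lambda>S. if S = b ` M then single (\<mu> + indicator_mon (a ` M)) 1 else 0) S = koszul \<rho> (u 0) S" for S
      using u(3) unfolding c_def W_def .
    fix q T assume q: "q \<in> ?J" and T: "T \<in> transversals"
    let ?m = "\<mu> + indicator_mon (U - T)" and ?C = "T \<union> - U"
    \<comment> \<open>An edge inside \<open>U\<close> belongs to \<open>M\<close> because the
      matching is induced, and so meets the transversal \<open>T\<close>; any other edge has a
      vertex outside \<open>U\<close>.\<close>
    have cover: "e \<inter> ?C \<noteq> {}" if "e \<in> E" for e
    proof (cases "e \<subseteq> U")
      case True
      then have "e \<in> M" using ind that UM by blast
      moreover have "a e \<in> e" "b e \<in> e" using ab(1)[OF \<open>e \<in> M\<close>] by blast+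
      moreover have "a e \<in> T \<longleftrightarrow> b e \<notin> T" using T \<open>e \<in> M\<close> by (simp add: transversals_def)
      ultimately show ?thesis by blast
    qed blast
    have e0T: "a e0 \<in> U" "b e0 \<in> U" "a e0 \<in> T \<longleftrightarrow> b e0 \<notin> T"
      using T e0 by (auto simp: transversals_def U_def)
    \<comment> \<open>On the cover, the factor for \<open>U - T\<close> contributes nothing, and
      exactly one endpoint of \<open>e0\<close> lies in \<open>T\<close>. The weight is thus
      \<open>s - 1\<close>, too small for a monomial of the power.\<close>
    have "(\<Sum>v\<in>?C. lookup ?m v) = (\<Sum>v\<in>?C. lookup \<mu> v)"
      using T by (intro sum.cong) (auto simp: lookup_add lookup_indicator_mon transversals_def)
    also have "\<dots> = s'"
      using e0T by (auto simp: \<mu>_def lookup_add lookup_single when_def sum.distrib)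
    finally have "\<not> s \<le> (\<Sum>v\<in>?C. lookup ?m v)" using s' by simp
    then show "lookup q ?m = 0" using edge_ideal_power_cover_weight[OF cover q, of ?m]
      by (auto simp: in_keys_iff)
  qed
qed

text \<open>The hypothesis \<open>E \<noteq> {}\<close> excludes the zero ideal, whose regularity is
  -\<infinity> by convention.\<close>

theorem theorem4p5:
  fixes E :: "'v::finite set set" and s :: nat
  assumes "simple_graph E" and "E \<noteq> {}" and "s \<ge> 1"
  shows "ideal_regularity (ideal_power (edge_ideal E :: ('v, 'k::field) mpoly set) s)
           \<ge> ereal (2 * real s + real (induced_matching_number E) - 1)"
proof -
  let ?J = "ideal_power (edge_ideal E :: ('v, 'k) mpoly set) s"
  let ?X = "{card M | M. induced_matching E M}"
  have fin: "finite ?X" by simp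
  obtain e where e: "e \<in> E" using assms(2) by blast
  \<comment> \<open>All edges have two elements, so none lies properly inside another. Hence a
    single edge is an induced matching and the maximal one is non-empty.\<close>
  have "{e' \<in> E. e' \<subseteq> e} = {e}"
    using assms(1) e by (auto simp: simple_graph_def dest: card_subset_eq[OF finite])
  then have "induced_matching E {e}" using e by (auto simp: induced_matching_def)
  then have 1: "card {e} \<in> ?X" by blast
  then have "induced_matching_number E \<in> ?X"
    unfolding induced_matching_number_def using fin by (intro Max_in) auto
  then obtain M where M: "induced_matching E M" "induced_matching_number E = card M" by blast
  have "card {e} \<le> card M"
    unfolding M(2)[symmetric] induced_matching_number_def using fin 1 by (rule Max_ge)
  then have "M \<noteq> {}" by auto
  \<comment> \<open>This is the very resolution chosen in \<open>graded_betti\<close>; existence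
    guarantees that the choice is a minimal graded free resolution.\<close>
  define F where "F = (SOME F. minimal_graded_free_resolution (*) homog ?J F)"
  have "monomial_ideal ?J" by (intro monomial_ideal_power monomial_ideal_edge_ideal)
  then have F: "minimal_graded_free_resolution (*) homog ?J F"
    unfolding F_def by (intro someI_ex[of "minimal_graded_free_resolution (*) homog ?J"]) (rule minimal_graded_free_resolution_exists)
  let ?i = "card M - 1" and ?d = "2 * int s + 2 * int (card M) - 2"
  obtain c where c: "c < rk F ?i" "shift F ?i c = ?d"
    using induced_matching_shift[OF assms(1) M(1) \<open>M \<noteq> {}\<close> _ F] assms(3) by auto
  define X where "X = {b. b < rk F ?i \<and> shift F ?i b = ?d}"
  have "finite X" "c \<in> X" using c by (simp_all add: X_def)
  then have "card X \<noteq> 0" by auto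
  moreover have "graded_betti (*) homog ?J ?i ?d = card X"
    by (simp add: graded_betti_def F_def Let_def X_def)
  ultimately have "graded_betti (*) homog ?J ?i ?d \<noteq> 0" by simp
  then have "ereal (real_of_int (?d - int ?i)) \<le> ideal_regularity ?J"
    unfolding ideal_regularity_def regularity_def by (intro Sup_upper) blast
  moreover have "real_of_int (?d - int ?i) = 2 * real s + real (card M) - 1"
    using \<open>card {e} \<le> card M\<close> by (simp add: of_nat_diff)
  ultimately show ?thesis by (simp only: M(2))
qed

end
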